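(* Let $k \geq 1$ be an integer. There exist an integer $N_0(k)$ and a function $c_k:[0,\infty)\to[0,\infty)$ depending only on $k$ with $c_k(\varepsilon) \to 0$ as $\varepsilon \to 0$, such that for every integer $N \geq N_0(k)$ and every $f: [N] \to \mathbf{C}$ with $\|f\|_{L^\infty([N])} \leq 1$: (1) (Extremisers) $\|f\|_{U^k([N])} = 1$ if and only if $f = e(P)$ on $[N]$ for some polynomial $P: \mathbf{Z} \to \mathbf{R}/\mathbf{Z}$ of degree $\leq k-1$; (2) (Near-extremisers) for every $\varepsilon \geq 0$, if $\|f\|_{U^k([N])} \geq 1-\varepsilon$ then there exists a polynomial $P: \mathbf{Z} \to \mathbf{R}/\mathbf{Z}$ of degree $\leq k-1$ such that $\|f-e(P)\|_{L^1([N])} \leq c_k(\varepsilon)$.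
   Context: $[N] := \{1,\dots,N\}$, and $L^p([N])$ norms are taken with respect to normalised counting measure, e.g. $\|g\|_{L^1([N])} = \frac1N\sum_{n=1}^N |g(n)|$. For a finite abelian group $G$ with normalised counting measure, the Gowers norm is $\|f\|_{U^k(G)} := \left(\mathbb{E}_{x,h_1,\dots,h_k \in G} \prod_{\omega \in \{0,1\}^k} \mathcal{C}^{|\omega|} f(x+\omega_1h_1+\dots+\omega_kh_k)\right)^{1/2^k}$, with $\mathcal{C}$ complex conjugation and $|\omega|=\omega_1+\dots+\omega_k$. For $f:[N]\to\mathbf{C}$, $\|f\|_{U^k([N])} := \|\tilde f\|_{U^k(\mathbf{Z}/\tilde N\mathbf{Z})}/\|1_{[N]}\|_{U^k(\mathbf{Z}/\tilde N\mathbf{Z})}$, where $\tilde N > 2^k N$ is any integer (the value is independent of this choice), $[N]$ is embedded in $\mathbf{Z}/\tilde N\mathbf{Z}$ in the obvious way and $\tilde f$ is the extension of $f$ by zero. A map $P: \mathbf{Z} \to \mathbf{R}/\mathbf{Z}$ is a polynomial of degree $\leq d$ if $\Delta_{h_1}\cdots\Delta_{h_{d+1}}P \equiv 0$ for all $h_i \in \mathbf{Z}$, where $\Delta_h P(x) := P(x-h)-P(x)$; equivalently $P(n) = \sum_{i=0}^d c_i n^i \bmod 1$ with $c_i \in \mathbf{R}$. $e(x) := e^{2\pi i x}$. *)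

theory Defs
  imports "HOL-Analysis.Analysis"
begin

definition e :: "real \<Rightarrow> complex" where
  "e x = cis (2 * pi * x)"

fun diff_iter :: "int list \<Rightarrow> (int \<Rightarrow> real) \<Rightarrow> int \<Rightarrow> real" where
  "diff_iter [] P x = P x"
| "diff_iter (h # hs) P x = diff_iter hs P (x - h) - diff_iter hs P x"

text \<open>A polynomial Z -> R/Z of degree <= d, represented by a real-valued lift P
  (so values are taken mod 1): all (d+1)-fold differences vanish mod 1.\<close>
definition poly_RZ :: "nat \<Rightarrow> (int \<Rightarrow> real) \<Rightarrow> bool" where
  "poly_RZ d P \<longleftrightarrow> (\<forall>hs x. length hs = d + 1 \<longrightarrow> diff_iter hs P x \<in> \<int>)"

text \<open>Gowers U^k norm on Z/MZ (normalised counting measure); g is read on residues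
  {0..<M}, points of Z/MZ.  The cube vertex omega is the set S of indices i with omega_i = 1.\<close>
definition gowers_cyc :: "nat \<Rightarrow> nat \<Rightarrow> (int \<Rightarrow> complex) \<Rightarrow> real" where
  "gowers_cyc M k g =
     root (2 ^ k) (Re ((1 / of_nat M ^ (k + 1)) *
       (\<Sum>x\<in>{0..<int M}. \<Sum>h\<in>PiE {..<k} (\<lambda>_. {0..<int M}).
          \<Prod>S\<in>Pow {..<k}.
            (if even (card S) then (\<lambda>z. z) else cnj)
              (g ((x + (\<Sum>i\<in>S. h i)) mod int M)))))"

text \<open>Extension by zero of f : [N] -> C to Z/MZ, [N] = {1..N} embedded in the obvious way
  (requires M > N).\<close>
definition ext0 :: "nat \<Rightarrow> (int \<Rightarrow> complex) \<Rightarrow> int \<Rightarrow> complex" where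
  "ext0 N f y = (if 1 \<le> y \<and> y \<le> int N then f y else 0)"

text \<open>U^k([N]) norm, using the admissible choice Ntilde = 2^k N + 1 > 2^k N.\<close>
definition gowers_N :: "nat \<Rightarrow> nat \<Rightarrow> (int \<Rightarrow> complex) \<Rightarrow> real" where
  "gowers_N k N f =
     gowers_cyc (2 ^ k * N + 1) k (ext0 N f) / gowers_cyc (2 ^ k * N + 1) k (ext0 N (\<lambda>_. 1))"

definition L1_N :: "nat \<Rightarrow> (int \<Rightarrow> complex) \<Rightarrow> real" where
  "L1_N N g = (\<Sum>n\<in>{1..int N}. cmod (g n)) / real N"

end

theory Submission
  imports Defs
begin

text \<open>Since the modulus exceeds \<open>2^k N\<close>, the \<open>2^k\<close>-th power of the norm is the average of the cube products over
  the integer cubes with all vertices in \<open>[N]\<close>. If it is nearly 1, then after writing \<open>f = |f| e(F)\<close> most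
  cubes have \<open>k\<close>-fold difference of \<open>F\<close> close to an integer.

  As in polynomiality testing, let \<open>G(x)\<close> be the value of \<open>F(x)\<close> predicted by a typical cube with corner \<open>x\<close>.
  Two predictions usually agree, because changing one direction at a time changes the prediction by another, equidistributed
  cube. So \<open>G\<close> is close to \<open>F\<close> at most points, while every \<open>k\<close>-fold difference of \<open>G\<close> is close to an integer.

  Such a \<open>G\<close> is uniformly close to a polynomial modulo 1: it lifts to a real function with small differences, whose
  \<open>(k-1)\<close>-fold difference is nearly independent of the base point and nearly additive in each direction, hence (Hyers)
  close to \<open>c h_1 \<dots> h_{k-1}\<close>. Subtracting a multiple of \<open>x^{k-1}\<close> lowers the degree. For exact extremisers
  self-correction is not needed and all errors vanish.\<close>

subsection \<open>Distance to the nearest integer and iterated differences\<close>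

text \<open>The stability statement needs every cube in \<open>[N]\<close>, whereas a large average
  controls only most cubes. Self-correction bridges the two, so the corrected value must exist at
  every point, even near the ends of the interval, where a cube with corner \<open>x\<close> has
  room on one side only. The directions voting at \<open>x\<close> therefore depend on
  \<open>x\<close>, and an argument that on a group would use one set of directions for all base
  points must here follow a moving box. All ranges of averaging are proportional to
  \<open>N\<close>: a fixed cube is compared with random cubes produced by noise of range
  \<open>L\<close>, where \<open>L\<close> is of order \<open>N / k^2\<close>, and this succeeds as
  soon as the bad cubes number fewer than \<open>L ^ (k + 1) / (2 ^ k * (k + 1))\<close>. Since
  there are at most a constant times \<open>L ^ (k + 1)\<close> cubes in all, the thresholds depend
  on \<open>k\<close> but not on \<open>N\<close>. The tolerated phase error \<kappa> is chosen
  before the permitted average defect, because the latter must be small compared with the loss that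
  a phase error \<kappa> causes in the cosine.\<close>

definition nint_dist :: "real \<Rightarrow> real" where
  "nint_dist x = \<bar>x - of_int (round x)\<bar>"

lemma nint_dist_le_iff: "nint_dist x \<le> c \<longleftrightarrow> (\<exists>m::int. \<bar>x - of_int m\<bar> \<le> c)"
proof
  assume "\<exists>m::int. \<bar>x - of_int m\<bar> \<le> c"
  then obtain m :: int where "\<bar>x - of_int m\<bar> \<le> c" by blast
  then show "nint_dist x \<le> c"
    using round_diff_minimal[of x m] by (simp add: nint_dist_def)
qed (auto simp: nint_dist_def)

lemma nint_dist_leI: "\<bar>x - of_int m\<bar> \<le> c \<Longrightarrow> nint_dist x \<le> c"
  using nint_dist_le_iff by blast

lemma nint_dist_nonneg: "0 \<le> nint_dist x"
  by (simp add: nint_dist_def)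

lemma nint_dist_le_half: "nint_dist x \<le> 1 / 2"
  using of_int_round_abs_le[of x] by (simp add: nint_dist_def abs_minus_commute)

lemma nint_dist_add: "nint_dist (x + y) \<le> nint_dist x + nint_dist y"
  by (rule nint_dist_leI[of _ "round x + round y"]) (simp add: nint_dist_def)

lemma nint_dist_minus [simp]: "nint_dist (- x) = nint_dist x"
proof -
  have "nint_dist (- x) \<le> nint_dist x" for x
    by (rule nint_dist_leI[of _ "- round x"]) (simp add: nint_dist_def)
  from this[of x] this[of "- x"] show ?thesis by simp
qed

lemma nint_dist_diff: "nint_dist (x - y) \<le> nint_dist x + nint_dist y"
  using nint_dist_add[of x "- y"] by simp

lemma nint_dist_sum: "nint_dist (sum f A) \<le> (\<Sum>a\<in>A. nint_dist (f a))"
proof (induction A rule: infinite_finite_induct)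
  case (insert a A)
  then show ?case using nint_dist_add[of "f a" "sum f A"] by simp
qed (simp_all add: nint_dist_def)

lemma nint_dist_sign_mult [simp]: "nint_dist ((-1) ^ n * x) = nint_dist x"
  by (cases "even n") simp_all

lemma nint_dist_add_int [simp]: "nint_dist (x + of_int m) = nint_dist x"
proof -
  have *: "nint_dist (x + of_int m) \<le> nint_dist x" for x m
    by (rule nint_dist_leI[of _ "round x + m"]) (simp add: nint_dist_def)
  from *[of x m] *[of "x + of_int m" "- m"] show ?thesis by simp
qed

section \<open>Alternating sums over the vertices of a cube\<close>

definition cube_diff :: "'i set \<Rightarrow> (int \<Rightarrow> real) \<Rightarrow> int \<Rightarrow> ('i \<Rightarrow> int) \<Rightarrow> real" where
  "cube_diff I F x h = (\<Sum>S\<in>Pow I. (-1) ^ card S * F (x + sum h S))"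

lemma cube_diff_empty [simp]: "cube_diff {} F x h = F x"
  by (simp add: cube_diff_def)

lemma cube_diff_cong:
  assumes "\<And>i. i \<in> I \<Longrightarrow> h i = h' i"
  shows "cube_diff I F x h = cube_diff I F x h'"
proof -
  have "sum h S = sum h' S" if "S \<subseteq> I" for S
    using that assms by (intro sum.cong) auto
  then show ?thesis by (simp add: cube_diff_def)
qed

lemma cube_diff_insert:
  assumes "finite I" "j \<notin> I"
  shows "cube_diff (insert j I) F x h = cube_diff I F x h - cube_diff I F (x + h j) h"
proof -
  have inj: "inj_on (insert j) (Pow I)"
    using assms by (auto simp: inj_on_def)
  have "(\<Sum>S\<in>insert j ` Pow I. (-1) ^ card S * F (x + sum h S))
      = (\<Sum>S\<in>Pow I. - ((-1) ^ card S * F (x + h j + sum h S)))"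
    unfolding sum.reindex[OF inj] comp_def
  proof (intro sum.cong refl)
    fix S assume "S \<in> Pow I"
    then have "finite S" "j \<notin> S" using assms finite_subset by auto
    then show "(- 1) ^ card (insert j S) * F (x + sum h (insert j S))
        = - ((- 1) ^ card S * F (x + h j + sum h S))"
      by (simp add: add.assoc)
  qed
  moreover have "Pow I \<inter> insert j ` Pow I = {}" using assms by auto
  ultimately show ?thesis using assms
    by (simp add: cube_diff_def Pow_insert sum.union_disjoint sum_negf)
qed

lemma cube_diff_upd:
  assumes "finite I" "j \<in> I"
  shows "cube_diff I F x (h(j := t))
       = cube_diff (I - {j}) F x h - cube_diff (I - {j}) F (x + t) h"
proof -
  have "cube_diff I F x (h(j := t)) = cube_diff (insert j (I - {j})) F x (h(j := t))"
    using assms by (simp add: insert_absorb)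
  also have "\<dots> = cube_diff (I - {j}) F x (h(j := t)) - cube_diff (I - {j}) F (x + t) (h(j := t))"
    using assms by (subst cube_diff_insert) auto
  also have "\<dots> = cube_diff (I - {j}) F x h - cube_diff (I - {j}) F (x + t) h"
    by (intro arg_cong2[where f = "(-)"] cube_diff_cong) auto
  finally show ?thesis .
qed

lemma cube_diff_remove:
  assumes "finite I" "j \<in> I"
  shows "cube_diff I F x h = cube_diff (I - {j}) F x h - cube_diff (I - {j}) F (x + h j) h"
  using cube_diff_upd[OF assms, of F x h "h j"] by simp

text \<open>Two cubes stacked along direction \<open>j\<close> share a face, which enters once with
  each sign and cancels. This cocycle rule is the source of approximate additivity and of every
  subdivision of a long cube.\<close>

lemma cube_diff_upd_add:
  assumes "finite I" "j \<in> I"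
  shows "cube_diff I F x (h(j := s + t))
       = cube_diff I F x (h(j := s)) + cube_diff I F (x + s) (h(j := t))"
  by (simp add: cube_diff_upd[OF assms] add.assoc)

lemma cube_diff_zero_dir:
  assumes "finite I" "j \<in> I" "h j = 0"
  shows "cube_diff I F x h = 0"
  using cube_diff_remove[OF assms(1,2), of F x h] assms(3) by simp

lemma cube_diff_add: "cube_diff I (\<lambda>y. F y + G y) x h = cube_diff I F x h + cube_diff I G x h"
  by (simp add: cube_diff_def distrib_left sum.distrib)

lemma cube_diff_diff: "cube_diff I (\<lambda>y. F y - G y) x h = cube_diff I F x h - cube_diff I G x h"
  by (simp add: cube_diff_def right_diff_distrib sum_subtractf)

lemma cube_diff_cmult: "cube_diff I (\<lambda>y. c * F y) x h = c * cube_diff I F x h"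
  by (simp add: cube_diff_def sum_distrib_left mult.left_commute)

lemma cube_diff_sum:
  "cube_diff I (\<lambda>y. \<Sum>a\<in>A. F a y) x h = (\<Sum>a\<in>A. cube_diff I (F a) x h)"
proof (induction A rule: infinite_finite_induct)
  case (insert a A)
  then show ?case by (simp add: cube_diff_add)
qed (simp_all add: cube_diff_def)

lemma cube_diff_shift: "cube_diff I (\<lambda>y. F (y + s)) x h = cube_diff I F (x + s) h"
  by (simp add: cube_diff_def algebra_simps)

lemma cube_diff_image:
  assumes "inj_on f I"
  shows "cube_diff (f ` I) F x h = cube_diff I F x (h \<circ> f)"
proof -
  have inj: "inj_on ((`) f) (Pow I)"
    using assms by (metis inj_on_image_Pow)
  have "cube_diff (f ` I) F x h
      = (\<Sum>S\<in>Pow I. (-1) ^ card (f ` S) * F (x + sum h (f ` S)))"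
    unfolding cube_diff_def image_Pow_surj[OF refl, symmetric] sum.reindex[OF inj] comp_def ..
  also have "\<dots> = cube_diff I F x (h \<circ> f)"
    unfolding cube_diff_def
    using assms by (intro sum.cong refl)
      (metis PowD card_image inj_on_subset sum.reindex)
  finally show ?thesis .
qed

text \<open>Each difference in \<open>diff_iter\<close> subtracts the value at \<open>x\<close> from
  the value at \<open>x - h\<close>, whereas \<open>cube_diff\<close> counts the corner positively
  and moves by \<open>+ h\<close>; hence the reversed directions and one sign per
  difference.\<close>

lemma diff_iter_cube_diff:
  "diff_iter hs P x = (-1) ^ length hs * cube_diff {..<length hs} P x (\<lambda>i. - (hs ! i))"
proof (induction hs arbitrary: x)
  case (Cons h hs)
  have ins: "{..<length (h # hs)} = insert 0 (Suc ` {..<length hs})"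
    by (simp add: lessThan_Suc_eq_insert_0)
  have "cube_diff {..<length (h # hs)} P x (\<lambda>i. - ((h # hs) ! i))
     = cube_diff {..<length hs} P x (\<lambda>i. - (hs ! i)) - cube_diff {..<length hs} P (x - h) (\<lambda>i. - (hs ! i))"
    unfolding ins by (subst cube_diff_insert) (auto simp: cube_diff_image comp_def)
  then have "(-1) ^ length hs * cube_diff {..<length (h # hs)} P x (\<lambda>i. - ((h # hs) ! i))
      = diff_iter hs P x - diff_iter hs P (x - h)"
    by (simp only: Cons.IH right_diff_distrib)
  then show ?case by simp
qed simp

lemma poly_RZ_iff_cube_diff:
  "poly_RZ d P \<longleftrightarrow> (\<forall>x h. cube_diff {..<Suc d} P x h \<in> \<int>)"
proof -
  have sgn: "(-1) ^ n * y \<in> \<int> \<longleftrightarrow> y \<in> \<int>" for n and y :: real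
    by (cases "even n") auto
  show ?thesis
  proof (intro iffI allI)
    fix x h assume *: "poly_RZ d P"
    let ?hs = "map (\<lambda>i. - h i :: int) [0..<Suc d]"
    have "diff_iter ?hs P x \<in> \<int>"
      using * unfolding poly_RZ_def by (metis Suc_eq_plus1 diff_zero length_map length_upt)
    moreover have "cube_diff {..<Suc d} P x (\<lambda>i. - (?hs ! i)) = cube_diff {..<Suc d} P x h"
      by (rule cube_diff_cong) (simp del: upt_Suc)
    ultimately show "cube_diff {..<Suc d} P x h \<in> \<int>"
      unfolding diff_iter_cube_diff sgn by (simp del: upt_Suc)
  qed (simp add: poly_RZ_def diff_iter_cube_diff sgn)
qed

text \<open>One difference in direction \<open>j\<close> turns \<open>y ^ n\<close> into a
  polynomial of degree below \<open>n\<close> whose coefficient at \<open>y ^ (n - 1)\<close> is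
  \<open>- n * h j\<close>. The remaining directions annihilate all lower terms, and the leading
  factors multiply up to the factorial.\<close>

lemma cube_diff_power:
  assumes "finite I" "n \<le> card I"
  shows "cube_diff I (\<lambda>y. of_int y ^ n) x h
       = (if n = card I then (-1) ^ n * fact n * (\<Prod>i\<in>I. of_int (h i)) else 0)"
  using assms
proof (induction I arbitrary: n x rule: finite_induct)
  case (insert j I)
  have "cube_diff (insert j I) (\<lambda>y. of_int y ^ n) x h
      = cube_diff I (\<lambda>y. of_int y ^ n - of_int (y + h j) ^ n) x h"
    using insert.hyps
    by (simp add: cube_diff_insert cube_diff_diff cube_diff_shift[of I "\<lambda>y. of_int y ^ n", symmetric])
  also have "(\<lambda>y. of_int y ^ n - of_int (y + h j) ^ n :: real)
      = (\<lambda>y. \<Sum>m<n. (- (of_nat (n choose m) * of_int (h j) ^ (n - m))) * of_int y ^ m)"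
  proof
    fix y
    have "(of_int (y + h j) ^ n :: real)
        = (\<Sum>m\<le>n. of_nat (n choose m) * of_int y ^ m * of_int (h j) ^ (n - m))"
      by (simp add: binomial_ring)
    also have "\<dots> = (\<Sum>m<n. of_nat (n choose m) * of_int y ^ m * of_int (h j) ^ (n - m)) + of_int y ^ n"
      by (simp add: lessThan_Suc_atMost[symmetric])
    finally show "of_int y ^ n - of_int (y + h j) ^ n
      = (\<Sum>m<n. (- (of_nat (n choose m) * of_int (h j) ^ (n - m))) * of_int y ^ m :: real)"
      by (simp add: sum_negf mult_ac)
  qed
  also have "cube_diff I \<dots> x h
      = (\<Sum>m<n. - (of_nat (n choose m) * of_int (h j) ^ (n - m)) * cube_diff I (\<lambda>y. of_int y ^ m) x h)"
    unfolding cube_diff_sum cube_diff_cmult ..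
  also have "\<dots> = (\<Sum>m<n. - (of_nat (n choose m) * of_int (h j) ^ (n - m)) *
      (if m = card I then (-1) ^ m * fact m * (\<Prod>i\<in>I. of_int (h i)) else 0))"
    using insert by (intro sum.cong refl arg_cong2[where f = "(*)"]) auto
  also have "\<dots> = (if n = card (insert j I) then (-1) ^ n * fact n * (\<Prod>i\<in>insert j I. of_int (h i)) else 0)"
  proof (cases "n = card (insert j I)")
    case True
    then have n: "n = Suc (card I)" using insert by simp
    show ?thesis unfolding n using insert.hyps
      by (simp add: if_distrib sum.delta cong: if_cong)
  next
    case False
    then have "n \<le> card I" using insert by simp
    then show ?thesis using False by (auto intro!: sum.neutral)
  qed
  finally show ?case .
qed (auto simp: cube_diff_def)

subsection \<open>Stability of polynomials on an interval\<close>

text \<open>The limit of \<open>A (2 ^ n * h) / 2 ^ n\<close> from Hyers' argument would leave the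
  interval, so the candidate linear function is the chord through \<open>(0, 0)\<close> and
  \<open>(H, A H)\<close>.\<close>

lemma approx_additive_interval:
  fixes A :: "int \<Rightarrow> real"
  assumes add: "\<And>a b. 0 \<le> a \<Longrightarrow> 0 \<le> b \<Longrightarrow> a + b \<le> H \<Longrightarrow> \<bar>A (a + b) - A a - A b\<bar> \<le> \<eta>"
    and H: "1 \<le> H" and h: "0 \<le> h" "h \<le> H"
  shows "\<bar>A h - of_int h / of_int H * A H\<bar> \<le> 3 * \<eta>"
proof -
  define B where "B u = A u - of_int u / of_int H * A H" for u
  \<comment> \<open>An extremal value of \<open>B\<close>, reflected to the lower half if necessary, is nearly doubled by \<open>B (2 * u)\<close>.\<close>
  have BH: "B H = 0" using H by (simp add: B_def)
  have Badd: "\<bar>B (a + b) - B a - B b\<bar> \<le> \<eta>" if "0 \<le> a" "0 \<le> b" "a + b \<le> H" for a b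
  proof -
    have "B (a + b) - B a - B b = A (a + b) - A a - A b"
      by (simp add: B_def add_divide_distrib distrib_right)
    then show ?thesis using add[OF that] by simp
  qed
  define M where "M = Max ((\<lambda>u. \<bar>B u\<bar>) ` {0..H})"
  have M: "\<bar>B u\<bar> \<le> M" if "0 \<le> u" "u \<le> H" for u
    unfolding M_def using that by (intro Max_ge) auto
  have "M \<in> (\<lambda>u. \<bar>B u\<bar>) ` {0..H}"
    unfolding M_def using H by (intro Max_in) auto
  then obtain u where u: "0 \<le> u" "u \<le> H" "\<bar>B u\<bar> = M" by auto
  have \<eta>: "0 \<le> \<eta>" using Badd[of 0 0] H by linarith
  have "M \<le> 3 * \<eta>"
  proof (cases "2 * u \<le> H")
    case True
    then show ?thesis using Badd[of u u] M[of "u + u"] u \<eta> by (simp add: abs_le_iff abs_if split: if_splits)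
  next
    \<comment> \<open>As \<open>B H = 0\<close>, the reflected value \<open>B (H - u)\<close> equals
      \<open>- B u\<close> up to \<eta>. Doubling the reflected point counts this error twice and
      adds one more \<eta>, whence the factor 3.\<close>
    case False
    then have "\<bar>B (H - u + (H - u)) - B (H - u) - B (H - u)\<bar> \<le> \<eta>" "\<bar>B (H - u + (H - u))\<bar> \<le> M"
      using u by (intro Badd M; simp)+
    moreover have "\<bar>B H - B (H - u) - B u\<bar> \<le> \<eta>" using Badd[of "H - u" u] u by simp
    ultimately show ?thesis using u(3) BH by linarith
  qed
  then show ?thesis using M[OF h] by (simp add: B_def)
qed

text \<open>\<open>(t i + K - 1) div K\<close> is the number of pieces when the side
  \<open>t i\<close> is cut into steps of length \<open>K\<close> and a remainder, so the product
  counts the small cubes of a grid whose differences add up by \<open>cube_diff_upd_add\<close>. All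
  sides are nonnegative, so the small cubes stay between \<open>x\<close> and
  \<open>x + sum t I\<close>.\<close>

lemma cube_diff_subdivide:
  assumes I: "finite I" and K: "1 \<le> K" and \<epsilon>: "0 \<le> \<epsilon>"
    and small: "\<And>x t. 1 \<le> x \<Longrightarrow> (\<And>i. i \<in> I \<Longrightarrow> 0 \<le> t i \<and> t i \<le> K) \<Longrightarrow> x + sum t I \<le> n
      \<Longrightarrow> \<bar>cube_diff I G x t\<bar> \<le> \<epsilon>"
    and x: "1 \<le> x" and t: "\<And>i. i \<in> I \<Longrightarrow> 0 \<le> t i" and n: "x + sum t I \<le> n"
  shows "\<bar>cube_diff I G x t\<bar> \<le> \<epsilon> * (\<Prod>i\<in>I. of_int ((t i + K - 1) div K))"
  using x t n
proof (induction "nat (sum t I)" arbitrary: x t rule: less_induct)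
  case less
  let ?w = "\<lambda>s. real_of_int ((s + K - 1) div K)"
  consider (zero) j where "j \<in> I" "t j = 0"
    | (small) "\<forall>i\<in>I. 1 \<le> t i \<and> t i \<le> K"
    | (large) j where "j \<in> I" "K < t j" "\<forall>i\<in>I. 1 \<le> t i"
    using less.prems(2) by (metis int_one_le_iff_zero_less linorder_le_less_linear order_antisym_conv)
  then show ?case
  proof cases
    case zero
    then have "(\<Prod>i\<in>I. ?w (t i)) = 0" using K by (intro prod_zero[OF I] bexI[of _ j]) auto
    then show ?thesis using cube_diff_zero_dir[OF I zero(1), of t G x] zero(2) by (simp only: mult_zero_right abs_zero order_refl)
  next
    case small
    have "1 \<le> (\<Prod>i\<in>I. ?w (t i))"
    proof (intro prod_ge_1)
      fix i assume "i \<in> I"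
      then have "K div K \<le> (t i + K - 1) div K" using small K by (intro zdiv_mono1) auto
      then show "1 \<le> ?w (t i)" using K by simp
    qed
    moreover have "\<bar>cube_diff I G x t\<bar> \<le> \<epsilon>"
      using small less.prems by (intro assms(4)) auto
    ultimately show ?thesis using mult_left_mono[OF _ \<epsilon>, of 1 "\<Prod>i\<in>I. ?w (t i)"] by simp
  next
    case large
    have I': "insert j (I - {j}) = I" using large by blast
    have sumupd: "sum (t(j := s)) I = sum t I - t j + s" for s
      using sum.remove[OF I \<open>j \<in> I\<close>, of t] sum.remove[OF I \<open>j \<in> I\<close>, of "t(j := s)"]
      by (simp add: sum.cong[of "I - {j}" "I - {j}" "t(j := s)" t])
    have le: "t j \<le> sum t I" using I large less.prems(2) by (intro member_le_sum) auto
    have produpd: "(\<Prod>i\<in>I. ?w ((t(j := s)) i)) = ?w s * (\<Prod>i\<in>I - {j}. ?w (t i))" for s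
      using prod.remove[OF I \<open>j \<in> I\<close>, of "\<lambda>i. ?w ((t(j := s)) i)"] by simp
    have 1: "\<bar>cube_diff I G x (t(j := K))\<bar> \<le> \<epsilon> * (\<Prod>i\<in>I. ?w ((t(j := K)) i))"
      using large less.prems K le by (intro less.hyps) (auto simp: sumupd[unfolded fun_upd_def])
    have 2: "\<bar>cube_diff I G (x + K) (t(j := t j - K))\<bar> \<le> \<epsilon> * (\<Prod>i\<in>I. ?w ((t(j := t j - K)) i))"
      using large less.prems K le by (intro less.hyps) (auto simp: sumupd[unfolded fun_upd_def])
    have "cube_diff I G x t = cube_diff I G x (t(j := K)) + cube_diff I G (x + K) (t(j := t j - K))"
      using cube_diff_upd_add[OF I \<open>j \<in> I\<close>, of G x t K "t j - K"] by simp
    moreover have "?w K + ?w (t j - K) = ?w (t j)"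
    proof -
      have "(K + K - 1) div K = 1 + (K - 1) div K" using K div_add_self1[of K "K - 1"] by (simp add: algebra_simps)
      moreover have "(t j + K - 1) div K = 1 + (t j - 1) div K"
        using K div_add_self2[of K "t j - 1"] by (simp add: algebra_simps)
      ultimately show ?thesis using K by simp
    qed
    ultimately have "\<bar>cube_diff I G x t\<bar> \<le> \<epsilon> * (?w (t j) * (\<Prod>i\<in>I - {j}. ?w (t i)))"
      using 1 2 unfolding produpd by (simp add: distrib_left distrib_right flip: \<open>?w K + ?w (t j - K) = ?w (t j)\<close>)
    then show ?thesis using produpd[of "t j"] by simp
  qed
qed

text \<open>Moving the base point costs one further difference, hence at most \<eta>. So the
  \<open>k\<close>-fold difference at base 1 is additive in each direction up to \<eta>, and one
  side after another can be linearised. The condition \<open>k * H < n\<close> makes room at base 1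
  for all cubes with sides up to \<open>H\<close>. The constant is 3 per direction, plus 1 for the
  passage from base 1 to \<open>x\<close>.\<close>

lemma approx_polynomial_top_coeff:
  assumes \<eta>: "\<And>x t. 1 \<le> x \<Longrightarrow> (\<And>i. i < Suc k \<Longrightarrow> 0 \<le> t i) \<Longrightarrow> x + sum t {..<Suc k} \<le> n
      \<Longrightarrow> \<bar>cube_diff {..<Suc k} G x t\<bar> \<le> \<eta>"
    and H: "1 \<le> H" "int k * H < n"
  shows "\<exists>c. \<forall>x t. 1 \<le> x \<longrightarrow> (\<forall>i<k. 0 \<le> t i \<and> t i \<le> H) \<longrightarrow> x + sum t {..<k} \<le> n \<longrightarrow>
    \<bar>cube_diff {..<k} G x t - c * (\<Prod>i<k. of_int (t i))\<bar> \<le> (3 * real k + 1) * \<eta>"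
proof -
  have step: "\<bar>cube_diff {..<k} G x t - cube_diff {..<k} G (x + s) t\<bar> \<le> \<eta>"
    if "1 \<le> x" "0 \<le> s" "\<And>i. i < k \<Longrightarrow> 0 \<le> t i" "x + s + sum t {..<k} \<le> n" for x s t
  proof -
    have "sum (t(k := s)) {..<k} = sum t {..<k}" by (intro sum.cong) auto
    then have "\<bar>cube_diff {..<Suc k} G x (t(k := s))\<bar> \<le> \<eta>"
      using that by (intro \<eta>) auto
    then show ?thesis
      using cube_diff_upd[of "{..<Suc k}" k G x t s] by (simp add: lessThan_Suc)
  qed
  define A where "A t = cube_diff {..<k} G 1 t" for t
  have sum_le: "sum t {..<k} \<le> int k * H" if "\<And>i. i < k \<Longrightarrow> t i \<le> H" for t
    using sum_bounded_above[of "{..<k}" t H] that by auto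
  have coord: "\<bar>A t - of_int (t j) / of_int H * A (t(j := H))\<bar> \<le> 3 * \<eta>"
    if j: "j < k" and t: "\<And>i. i < k \<Longrightarrow> 0 \<le> t i \<and> t i \<le> H" for t j
  proof -
    have "\<bar>A (t(j := u + v)) - A (t(j := u)) - A (t(j := v))\<bar> \<le> \<eta>"
      if uv: "0 \<le> u" "0 \<le> v" "u + v \<le> H" for u v
    proof -
      have "A (t(j := u + v)) = A (t(j := u)) + cube_diff {..<k} G (1 + u) (t(j := v))"
        unfolding A_def using j by (simp add: cube_diff_upd_add)
      moreover have "\<bar>cube_diff {..<k} G 1 (t(j := v)) - cube_diff {..<k} G (1 + u) (t(j := v))\<bar> \<le> \<eta>"
      proof (rule step)
        have "sum (t(j := s)) {..<k} = s + sum t ({..<k} - {j})" for s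
          using j by (subst sum.remove[of _ j]) (auto intro!: sum.cong)
        then have "u + sum (t(j := v)) {..<k} = sum (t(j := u + v)) {..<k}" by simp
        also have "\<dots> \<le> int k * H" using t uv by (intro sum_le) auto
        finally show "1 + u + sum (t(j := v)) {..<k} \<le> n" using H by simp
      qed (use uv t in auto)
      ultimately show ?thesis unfolding A_def by linarith
    qed
    from approx_additive_interval[where A = "\<lambda>u. A (t(j := u))", OF this H(1), of "t j"] t[OF j]
    show ?thesis by simp
  qed
  \<comment> \<open>The sides in \<open>J\<close> are replaced by \<open>H\<close> one by one; the
    factors \<open>t i / H\<close> already extracted are at most 1, so the errors merely
    add.\<close>
  have multi: "\<bar>A t - (\<Prod>i\<in>J. of_int (t i) / of_int H) * A (\<lambda>i. if i \<in> J then H else t i)\<bar>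
      \<le> 3 * real (card J) * \<eta>"
    if "J \<subseteq> {..<k}" and t: "\<And>i. i < k \<Longrightarrow> 0 \<le> t i \<and> t i \<le> H" for J t
  proof -
    have "finite J" using that finite_subset by blast
    then show ?thesis using that(1)
    proof (induction J rule: finite_induct)
      case (insert j J)
      let ?tJ = "\<lambda>i. if i \<in> J then H else t i"
      let ?p = "\<Prod>i\<in>J. real_of_int (t i) / of_int H"
      have p: "0 \<le> ?p" "?p \<le> 1"
        using insert t H by (auto intro!: prod_nonneg prod_le_1 simp: subset_iff)
      have upd: "?tJ(j := H) = (\<lambda>i. if i \<in> insert j J then H else t i)" by auto
      have "\<bar>A ?tJ - of_int (t j) / of_int H * A (?tJ(j := H))\<bar> \<le> 3 * \<eta>"
        using coord[of j ?tJ] insert t H by auto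
      note * = this[unfolded upd]
      let ?AJ = "A (\<lambda>i. if i \<in> insert j J then H else t i)"
      have eq: "A t - (\<Prod>i\<in>insert j J. of_int (t i) / of_int H) * ?AJ
        = (A t - ?p * A ?tJ) + ?p * (A ?tJ - of_int (t j) / of_int H * ?AJ)"
        using insert.hyps by (simp add: algebra_simps)
      have "\<bar>?p * (A ?tJ - of_int (t j) / of_int H * ?AJ)\<bar> \<le> 3 * \<eta>"
        unfolding abs_mult using p * mult_left_le_one_le[of "\<bar>A ?tJ - of_int (t j) / of_int H * ?AJ\<bar>" ?p]
        by linarith
      moreover have "\<bar>A t - ?p * A ?tJ\<bar> \<le> 3 * real (card J) * \<eta>"
        using insert by auto
      ultimately have "\<bar>(A t - ?p * A ?tJ) + ?p * (A ?tJ - of_int (t j) / of_int H * ?AJ)\<bar>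
          \<le> 3 * real (card J) * \<eta> + 3 * \<eta>"
        by linarith
      then show ?case unfolding eq using insert.hyps by (simp add: algebra_simps)
    qed simp
  qed
  define c where "c = A (\<lambda>_. H) / of_int H ^ k"
  show ?thesis
  proof (intro exI allI impI)
    fix x t
    assume x: "1 \<le> x" and t: "\<forall>i<k. 0 \<le> t i \<and> t i \<le> H" and n: "x + sum t {..<k} \<le> n"
    have "A (\<lambda>i. if i \<in> {..<k} then H else t i) = A (\<lambda>_. H)"
      unfolding A_def by (rule cube_diff_cong) simp
    then have "\<bar>A t - c * (\<Prod>i<k. of_int (t i))\<bar> \<le> 3 * real k * \<eta>"
      using multi[of "{..<k}" t] t by (simp add: c_def prod_dividef mult.commute)
    moreover have "\<bar>A t - cube_diff {..<k} G x t\<bar> \<le> \<eta>"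
      unfolding A_def using step[of 1 "x - 1" t] x t n by simp
    ultimately show "\<bar>cube_diff {..<k} G x t - c * (\<Prod>i<k. of_int (t i))\<bar> \<le> (3 * real k + 1) * \<eta>"
      by (simp add: distrib_right)
  qed
qed

text \<open>The top coefficient is controlled only on cubes with sides at most \<open>H\<close>;
  once its monomial is subtracted, subdivision carries the bound to all cubes. Since
  \<open>H\<close> is comparable to \<open>N / Suc k\<close>, the number of pieces, and with it
  \<open>C\<close>, depends on \<open>k\<close> only.\<close>

lemma approx_polynomial_real:
  "\<exists>C\<ge>0. \<forall>(N::nat) G \<eta>. k < N \<longrightarrow>
     (\<forall>x t. 1 \<le> x \<longrightarrow> (\<forall>i<k. 0 \<le> t i) \<longrightarrow> x + sum t {..<k} \<le> int N \<longrightarrow> \<bar>cube_diff {..<k} G x t\<bar> \<le> \<eta>) \<longrightarrow>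
     (\<exists>a. \<forall>x\<in>{1..int N}. \<bar>G x - (\<Sum>i<k. a i * of_int x ^ i)\<bar> \<le> C * \<eta>)"
proof (induction k)
  case 0
  show ?case by (rule exI[of _ 1]) auto
next
  case (Suc k)
  then obtain C where C: "0 \<le> C" and IH: "\<And>(N::nat) G \<eta>. k < N \<Longrightarrow>
     (\<And>x t. 1 \<le> x \<Longrightarrow> (\<forall>i<k. 0 \<le> t i) \<Longrightarrow> x + sum t {..<k} \<le> int N \<Longrightarrow> \<bar>cube_diff {..<k} G x t\<bar> \<le> \<eta>) \<Longrightarrow>
     (\<exists>a. \<forall>x\<in>{1..int N}. \<bar>G x - (\<Sum>i<k. a i * of_int x ^ i)\<bar> \<le> C * \<eta>)" by blast
  \<comment> \<open>Bounds the number of pieces of one side: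
    \<open>t i \<le> N - 1 < Suc k * (H + 1) \<le> 2 * Suc k * H\<close>, with one more allowed for
    rounding up.\<close>
  define m where "m = 2 * real (Suc k) + 1"
  define D where "D = m ^ k * (3 * real k + 1)"
  show ?case
  proof (intro exI[of _ "C * D"] conjI allI impI)
    show "0 \<le> C * D" using C by (simp add: D_def m_def)
    fix N :: nat and G :: "int \<Rightarrow> real" and \<eta> :: real
    assume N: "Suc k < N" and G: "\<forall>x t. 1 \<le> x \<longrightarrow> (\<forall>i<Suc k. 0 \<le> t i) \<longrightarrow>
      x + sum t {..<Suc k} \<le> int N \<longrightarrow> \<bar>cube_diff {..<Suc k} G x t\<bar> \<le> \<eta>"
    have \<eta>: "0 \<le> \<eta>"
      using G[rule_format, of 1 "\<lambda>_. 0"] N by simp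
    define H where "H = (int N - 1) div int (Suc k)"
    have H1: "1 \<le> H" unfolding H_def using N zdiv_mono1[of "int (Suc k)" "int N - 1" "int (Suc k)"] by simp
    have H2: "int (Suc k) * H \<le> int N - 1" unfolding H_def
      using mult_div_mod_eq[of "int (Suc k)" "int N - 1"] pos_mod_sign[of "int (Suc k)" "int N - 1"]
      by linarith
    have H3: "int N - 1 < int (Suc k) * (H + 1)" unfolding H_def
      using mult_div_mod_eq[of "int (Suc k)" "int N - 1"] pos_mod_bound[of "int (Suc k)" "int N - 1"]
      unfolding distrib_left mult_1_right by linarith
    have kH: "int k * H < int N" using H1 H2 by (simp add: distrib_right)
    obtain c where c: "\<And>x t. 1 \<le> x \<Longrightarrow> (\<forall>i<k. 0 \<le> t i \<and> t i \<le> H) \<Longrightarrow> x + sum t {..<k} \<le> int N \<Longrightarrow>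
      \<bar>cube_diff {..<k} G x t - c * (\<Prod>i<k. of_int (t i))\<bar> \<le> (3 * real k + 1) * \<eta>"
      using approx_polynomial_top_coeff[where n = "int N", OF _ H1 kH] G by blast
    \<comment> \<open>By \<open>cube_diff_power\<close>, this makes the \<open>k\<close>-fold
      difference of \<open>b * y ^ k\<close> equal to \<open>c\<close> times the product of the
      sides.\<close>
    define b where "b = (-1) ^ k * c / fact k"
    define G' where "G' y = G y - b * of_int y ^ k" for y
    have diff: "cube_diff {..<k} G' x t = cube_diff {..<k} G x t - c * (\<Prod>i<k. of_int (t i))" for x t
    proof -
      have "(-1::real) ^ k * (-1) ^ k = 1" by (simp flip: power_mult_distrib)
      then show ?thesis
        unfolding G'_def cube_diff_diff cube_diff_cmult by (simp add: cube_diff_power b_def)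
    qed
    have "\<bar>cube_diff {..<k} G' x t\<bar> \<le> D * \<eta>"
      if x: "1 \<le> x" and t: "\<forall>i<k. 0 \<le> t i" and n: "x + sum t {..<k} \<le> int N" for x t
    proof -
      have w: "real_of_int ((t i + H - 1) div H) \<le> m" if i: "i < k" for i
      proof -
        have "t i \<le> sum t {..<k}" using t i by (intro member_le_sum) auto
        then have "t i \<le> int N - 1" using n x by simp
        also have "\<dots> < int (Suc k) * (H + 1)" by (rule H3)
        also have "\<dots> \<le> int (Suc k) * (2 * H)" using H1 by (intro mult_left_mono) auto
        finally have "t i + H - 1 \<le> (2 * int (Suc k) + 1) * H" by (simp add: algebra_simps)
        then have "(t i + H - 1) div H \<le> (2 * int (Suc k) + 1) * H div H" using H1 by (intro zdiv_mono1) auto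
        then have "(t i + H - 1) div H \<le> 2 * int (Suc k) + 1" using H1 by simp
        then have "real_of_int ((t i + H - 1) div H) \<le> real_of_int (2 * int (Suc k) + 1)"
          by (simp only: of_int_le_iff)
        then show ?thesis by (simp add: m_def)
      qed
      have "(\<Prod>i<k. real_of_int ((t i + H - 1) div H)) \<le> (\<Prod>i<k. m)"
      proof (intro prod_mono conjI)
        fix i assume i: "i \<in> {..<k}"
        then have "0 \<le> t i" using t by simp
        then have "0 \<le> t i + H - 1" using H1 by linarith
        then show "0 \<le> real_of_int ((t i + H - 1) div H)" using H1 by (simp add: pos_imp_zdiv_nonneg_iff)
      qed (use w in auto)
      then have "(3 * real k + 1) * \<eta> * (\<Prod>i<k. real_of_int ((t i + H - 1) div H)) \<le> (3 * real k + 1) * \<eta> * m ^ k"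
        using \<eta> by (intro mult_left_mono) auto
      moreover have "\<bar>cube_diff {..<k} G' x t\<bar>
          \<le> (3 * real k + 1) * \<eta> * (\<Prod>i<k. of_int ((t i + H - 1) div H))"
        using x t n c \<eta> H1 by (intro cube_diff_subdivide[where n = "int N"]) (auto simp: diff)
      ultimately show ?thesis by (simp add: D_def mult_ac)
    qed
    then obtain a where a: "\<forall>x\<in>{1..int N}. \<bar>G' x - (\<Sum>i<k. a i * of_int x ^ i)\<bar> \<le> C * (D * \<eta>)"
      using IH[of N G' "D * \<eta>"] N by auto
    show "\<exists>a. \<forall>x\<in>{1..int N}. \<bar>G x - (\<Sum>i<Suc k. a i * of_int x ^ i)\<bar> \<le> C * D * \<eta>"
    proof (intro exI[of _ "a(k := b)"] ballI)
      fix x assume x: "x \<in> {1..int N}"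
      have "(\<Sum>i<k. (a(k := b)) i * of_int x ^ i) = (\<Sum>i<k. a i * of_int x ^ i)"
        by (intro sum.cong) auto
      then have "(\<Sum>i<Suc k. (a(k := b)) i * of_int x ^ i) = (\<Sum>i<k. a i * of_int x ^ i) + b * of_int x ^ k"
        unfolding sum.lessThan_Suc fun_upd_same by (rule arg_cong)
      then have "G x - (\<Sum>i<Suc k. (a(k := b)) i * of_int x ^ i) = G' x - (\<Sum>i<k. a i * of_int x ^ i)"
        unfolding G'_def by linarith
      then show "\<bar>G x - (\<Sum>i<Suc k. (a(k := b)) i * of_int x ^ i)\<bar> \<le> C * D * \<eta>"
        using a x by (metis mult.assoc)
    qed
  qed
qed

section \<open>From phases modulo 1 to real-valued functions\<close>

lemma nint_dist_small_imp_small: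
  assumes "nint_dist y \<le> \<eta>" "\<bar>y\<bar> \<le> 2 * \<eta>" "3 * \<eta> < 1"
  shows "\<bar>y\<bar> \<le> \<eta>"
proof -
  obtain m :: int where m: "\<bar>y - of_int m\<bar> \<le> \<eta>" using assms(1) nint_dist_le_iff by blast
  then have "\<bar>real_of_int m\<bar> < 1" using assms by linarith
  then have "m = 0" by linarith
  then show ?thesis using m by simp
qed

lemma cube_diff_of_int: "cube_diff I (\<lambda>y. of_int (m y)) x h \<in> \<int>"
  unfolding cube_diff_def by (intro Ints_sum Ints_mult) auto

text \<open>Adding an integer-valued function does not change a phase; choosing it to cancel the nearest integers of the unit
  cubes is what makes it possible to lift an approximate polynomial modulo 1 to the reals.\<close>

lemma cube_antidifference:
  fixes k :: nat
  shows "\<exists>m::int \<Rightarrow> int. \<forall>x\<ge>1. cube_diff {..<k} (\<lambda>y. of_int (m y)) x (\<lambda>_. 1) = of_int (r x)"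
proof (induction k arbitrary: r)
  case (Suc k)
  define \<rho> where "\<rho> x = - (\<Sum>y\<in>{1..<x}. r y)" for x
  have \<rho>: "\<rho> x - \<rho> (x + 1) = r x" if "1 \<le> x" for x
  proof -
    have "{1..<x + 1} = insert x {1..<x}" using that by auto
    then show ?thesis by (simp add: \<rho>_def)
  qed
  obtain m :: "int \<Rightarrow> int" where
    "\<forall>x\<ge>1. cube_diff {..<k} (\<lambda>y. of_int (m y)) x (\<lambda>_. 1) = of_int (\<rho> x)" using Suc by blast
  then have "\<forall>x\<ge>1. cube_diff {..<Suc k} (\<lambda>y. of_int (m y)) x (\<lambda>_. 1) = of_int (r x)"
    by (simp add: lessThan_Suc cube_diff_insert \<rho> flip: of_int_diff)
  then show ?case by blast
qed auto

text \<open>Induction on the total side length. The choice of \<open>m\<close> settles the unit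
  cubes; a longer cube splits into two shorter ones, so its difference has size at most
  \<open>2 * \<eta>\<close>. It also lies within \<eta> of an integer, which must be 0 because
  \<open>3 * \<eta> < 1\<close>. Thus each step restores the bound \<eta> instead of doubling
  it.\<close>

lemma lift_approx_polynomial:
  fixes k :: nat
  assumes k: "0 < k" and N: "1 \<le> n" and \<eta>: "3 * \<eta> < 1"
    and G: "\<And>x t. 1 \<le> x \<Longrightarrow> (\<forall>i<k. 0 \<le> t i) \<Longrightarrow> x + sum t {..<k} \<le> n \<Longrightarrow> nint_dist (cube_diff {..<k} G x t) \<le> \<eta>"
  obtains m :: "int \<Rightarrow> int" where
    "\<And>x t. 1 \<le> x \<Longrightarrow> (\<forall>i<k. 0 \<le> t i) \<Longrightarrow> x + sum t {..<k} \<le> n \<Longrightarrow>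
      \<bar>cube_diff {..<k} (\<lambda>y. G y + of_int (m y)) x t\<bar> \<le> \<eta>"
proof -
  obtain m :: "int \<Rightarrow> int" where m: "\<And>x. 1 \<le> x \<Longrightarrow>
    cube_diff {..<k} (\<lambda>y. of_int (m y)) x (\<lambda>_. 1) = of_int (- round (cube_diff {..<k} G x (\<lambda>_. 1)))"
    using cube_antidifference[of k "\<lambda>x. - round (cube_diff {..<k} G x (\<lambda>_. 1))"] by blast
  define G' where "G' y = G y + of_int (m y)" for y
  have \<eta>0: "0 \<le> \<eta>" using G[of 1 "\<lambda>_. 0"] N order_trans[OF nint_dist_nonneg] by simp
  have nint_dist_eq: "nint_dist (cube_diff {..<k} G' x t) = nint_dist (cube_diff {..<k} G x t)" for x t
    using cube_diff_of_int[of "{..<k}" m x t] unfolding G'_def cube_diff_add by (auto elim!: Ints_cases)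
  have "\<bar>cube_diff {..<k} G' x t\<bar> \<le> \<eta>"
    if "1 \<le> x" "\<forall>i<k. 0 \<le> t i" "x + sum t {..<k} \<le> n" for x t
    using that
  proof (induction "nat (sum t {..<k})" arbitrary: x t rule: less_induct)
    case less
    consider (zero) j where "j < k" "t j = 0"
      | (unit) "\<forall>i<k. t i = 1"
      | (large) j where "j < k" "1 < t j" "\<forall>i<k. 1 \<le> t i"
      using less.prems(2) by (metis int_one_le_iff_zero_less linorder_le_less_linear order_antisym_conv)
    then show ?case
    proof cases
      case zero
      then show ?thesis using \<eta>0 cube_diff_zero_dir[of "{..<k}" j t G' x] by simp
    next
      case unit
      then have "cube_diff {..<k} F x t = cube_diff {..<k} F x (\<lambda>_. 1)" for F
        by (intro cube_diff_cong) auto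
      then show ?thesis
        using G[of x t] less.prems m[of x] unfolding G'_def cube_diff_add nint_dist_def by simp
    next
      case large
      have j: "j \<in> {..<k}" using large by simp
      have sumupd: "sum (t(j := s)) {..<k} = sum t {..<k} - t j + s" for s
        using sum.remove[OF finite_lessThan j, of t] sum.remove[OF finite_lessThan j, of "t(j := s)"]
        by (simp add: sum.cong[of "{..<k} - {j}" "{..<k} - {j}" "t(j := s)" t])
      have le: "t j \<le> sum t {..<k}" using j less.prems(2) by (intro member_le_sum) auto
      have "\<bar>cube_diff {..<k} G' x (t(j := t j - 1))\<bar> \<le> \<eta>"
        using large less.prems le by (intro less.hyps) (auto simp: sumupd[unfolded fun_upd_def])
      moreover have "\<bar>cube_diff {..<k} G' (x + (t j - 1)) (t(j := 1))\<bar> \<le> \<eta>"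
        using large less.prems le by (intro less.hyps) (auto simp: sumupd[unfolded fun_upd_def])
      ultimately have "\<bar>cube_diff {..<k} G' x t\<bar> \<le> 2 * \<eta>"
        using cube_diff_upd_add[OF finite_lessThan j, of G' x t "t j - 1" 1] by simp
      then show ?thesis using nint_dist_small_imp_small G[OF less.prems] nint_dist_eq \<eta> by auto
    qed
  qed
  then show ?thesis using that unfolding G'_def by blast
qed

lemma approx_polynomial_mod_one:
  assumes k: "0 < k"
  shows "\<exists>C\<ge>0. \<forall>(N::nat) G \<eta>. k < N \<longrightarrow> 3 * \<eta> < 1 \<longrightarrow>
     (\<forall>x t. 1 \<le> x \<longrightarrow> (\<forall>i<k. 0 \<le> t i) \<longrightarrow> x + sum t {..<k} \<le> int N \<longrightarrow> nint_dist (cube_diff {..<k} G x t) \<le> \<eta>) \<longrightarrow>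
     (\<exists>P. poly_RZ (k - 1) P \<and> (\<forall>x\<in>{1..int N}. nint_dist (G x - P x) \<le> C * \<eta>))"
proof -
  obtain C where C: "0 \<le> C" and real: "\<forall>(N::nat) G \<eta>. k < N \<longrightarrow>
     (\<forall>x t. 1 \<le> x \<longrightarrow> (\<forall>i<k. 0 \<le> t i) \<longrightarrow> x + sum t {..<k} \<le> int N \<longrightarrow> \<bar>cube_diff {..<k} G x t\<bar> \<le> \<eta>) \<longrightarrow>
     (\<exists>a. \<forall>x\<in>{1..int N}. \<bar>G x - (\<Sum>i<k. a i * of_int x ^ i)\<bar> \<le> C * \<eta>)"
    using approx_polynomial_real by blast
  show ?thesis
  proof (intro exI[of _ C] conjI allI impI C)
    fix N :: nat and G :: "int \<Rightarrow> real" and \<eta> :: real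
    assume N: "k < N" and \<eta>: "3 * \<eta> < 1" and G: "\<forall>x t. 1 \<le> x \<longrightarrow> (\<forall>i<k. 0 \<le> t i) \<longrightarrow>
      x + sum t {..<k} \<le> int N \<longrightarrow> nint_dist (cube_diff {..<k} G x t) \<le> \<eta>"
    have N1: "1 \<le> int N" using N by simp
    obtain m :: "int \<Rightarrow> int" where m: "\<And>x t. 1 \<le> x \<Longrightarrow> (\<forall>i<k. 0 \<le> t i) \<Longrightarrow> x + sum t {..<k} \<le> int N \<Longrightarrow>
      \<bar>cube_diff {..<k} (\<lambda>y. G y + of_int (m y)) x t\<bar> \<le> \<eta>"
      using lift_approx_polynomial[OF k N1 \<eta>, of G] G by blast
    then obtain a where a: "\<And>x. x \<in> {1..int N} \<Longrightarrow> \<bar>G x + of_int (m x) - (\<Sum>i<k. a i * of_int x ^ i)\<bar> \<le> C * \<eta>"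
      using real[rule_format, OF N, of "\<lambda>y. G y + of_int (m y)" \<eta>] by blast
    define P where "P x = (\<Sum>i<k. a i * of_int x ^ i)" for x :: int
    have "cube_diff {..<k} P x h = 0" for x h
      unfolding P_def cube_diff_sum cube_diff_cmult by (simp add: cube_diff_power)
    then have "poly_RZ (k - 1) P" using k by (simp add: poly_RZ_iff_cube_diff)
    moreover have "nint_dist (G x - P x) \<le> C * \<eta>" if "x \<in> {1..int N}" for x
      using a[OF that] by (intro nint_dist_leI[of _ "- m x"]) (simp add: P_def algebra_simps)
    ultimately show "\<exists>P. poly_RZ (k - 1) P \<and> (\<forall>x\<in>{1..int N}. nint_dist (G x - P x) \<le> C * \<eta>)" by blast
  qed
qed

subsection \<open>Self-correction\<close>

text \<open>Both cubes contain the same face at \<open>x\<close> without direction \<open>j\<close>;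
  it cancels, and the two opposite faces bound one cube based at \<open>x + h j\<close>. This turns
  the comparison of two votes that differ in one direction into a statement about a single
  cube.\<close>

lemma cube_diff_upd_minus:
  assumes "finite I" "j \<in> I"
  shows "cube_diff I F x (h(j := t)) - cube_diff I F x h = cube_diff I F (x + h j) (h(j := t - h j))"
  using cube_diff_upd[OF assms, of F x h t] cube_diff_remove[OF assms, of F x h]
    cube_diff_upd[OF assms, of F "x + h j" h "t - h j"] by simp

lemma ex_le_average:
  fixes f :: "'a \<Rightarrow> nat"
  assumes "finite B" "B \<noteq> {}"
  shows "\<exists>y\<in>B. card B * f y \<le> sum f B"
proof -
  have "Min (f ` B) \<in> f ` B" using assms by (intro Min_in) auto
  then obtain y where "y \<in> B" "f y = Min (f ` B)" by auto
  moreover from this have "card B * f y \<le> sum f B"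
    using sum_bounded_below[of B "f y" f] assms by auto
  ultimately show ?thesis by blast
qed

section \<open>Cubes inside \<open>[N]\<close> and the boxes of voting directions\<close>

definition cubes :: "nat \<Rightarrow> nat \<Rightarrow> (int \<times> (nat \<Rightarrow> int)) set" where
  "cubes k N = {(x, h). h \<in> extensional {..<k} \<and> (\<forall>S\<subseteq>{..<k}. x + sum h S \<in> {1..int N})}"

lemma cubes_subset: "cubes k N \<subseteq> {1..int N} \<times> PiE {..<k} (\<lambda>_. {-int N..int N})"
proof (clarify, intro conjI)
  fix x h assume *: "(x, h) \<in> cubes k N"
  have x: "x \<in> {1..int N}" using * unfolding cubes_def by (auto dest!: spec[of _ "{}"])
  then show "x \<in> {1..int N}" .
  show "h \<in> PiE {..<k} (\<lambda>_. {-int N..int N})"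
  proof (rule PiE_I)
    fix i assume "i \<in> {..<k}"
    then have "x + h i \<in> {1..int N}" using * unfolding cubes_def by (auto dest!: spec[of _ "{i}"])
    then show "h i \<in> {-int N..int N}" using x by auto
  qed (use * in \<open>auto simp: cubes_def extensional_def\<close>)
qed

lemma finite_cubes: "finite (cubes k N)"
  using cubes_subset by (rule finite_subset) (intro finite_cartesian_product finite_PiE; simp)

text \<open>\<open>L\<close> is the range of each independent noise variable, and \<kappa> is the
  phase error up to which a cube counts as good. The factor \<open>16 * k^2\<close> is the product
  of the \<open>4 * k\<close> in the denominator of \<open>ctr\<close> and the \<open>4 * k\<close>
  in \<open>E + 2 \<le> 4 * k * L\<close>.\<close>

locale self_correction =
  fixes k N L :: nat and F :: "int \<Rightarrow> real" and \<kappa> :: real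
  assumes k: "1 \<le> k" and L: "1 \<le> L" and N: "16 * k\<^sup>2 * L \<le> N"
begin

text \<open>Every vertex \<open>x + sum h S\<close> with \<open>h\<close> in the box of \<open>x\<close> stays in \<open>[N]\<close> because the box is centred at
  \<open>(N/2 - x)/(2k)\<close>, the direction pulling \<open>x\<close> towards the middle of the interval. This centre is affine in \<open>x\<close>
  up to rounding, and the half-width \<open>E\<close> absorbs the rounding errors of \<open>k + 1\<close> divisions.\<close>

definition E :: int where "E = (int k + 1) * int L"

definition ctr :: "int \<Rightarrow> int" where "ctr x = (int N - 2 * x) div (4 * int k)"

definition U :: "int \<Rightarrow> int set" where "U x = {ctr x - E..ctr x + E}"

definition Box :: "int \<Rightarrow> (nat \<Rightarrow> int) set" where "Box x = PiE {..<k} (\<lambda>_. U x)"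

definition H :: nat where "H = nat (2 * E + 1)"

definition bad :: "(int \<times> (nat \<Rightarrow> int)) set" where
  "bad = {(x, h) \<in> cubes k N. \<kappa> < nint_dist (cube_diff {..<k} F x h)}"

lemma finite_bad: "finite bad"
  unfolding bad_def by (rule finite_subset[OF _ finite_cubes]) auto

lemma badI:
  assumes "\<And>S. S \<subseteq> {..<k} \<Longrightarrow> x + sum h S \<in> {1..int N}" "\<kappa> < nint_dist (cube_diff {..<k} F x h)"
  shows "(x, restrict h {..<k}) \<in> bad"
proof -
  have "sum (restrict h {..<k}) S = sum h S" if "S \<subseteq> {..<k}" for S
    using that by (intro sum.cong) auto
  moreover have "cube_diff {..<k} F x (restrict h {..<k}) = cube_diff {..<k} F x h"
    by (intro cube_diff_cong) auto
  ultimately show ?thesis using assms by (simp add: bad_def cubes_def)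
qed

lemma E_nonneg: "0 \<le> E" by (simp add: E_def)

lemma card_U: "card (U x) = H" by (simp add: U_def H_def)

lemma finite_U: "finite (U x)" by (simp add: U_def)

lemma L_le_H: "L \<le> H"
proof -
  have "int L \<le> E" unfolding E_def by (simp add: distrib_right)
  then show ?thesis using E_nonneg by (simp add: H_def)
qed

lemma card_Box: "card (Box x) = H ^ k"
  unfolding Box_def by (simp add: card_PiE card_U)

lemma finite_Box: "finite (Box x)"
  unfolding Box_def using finite_U by (intro finite_PiE) auto

lemma E_bound: "4 * int k * (E + 2) \<le> int N"
proof -
  have "E + 2 \<le> 4 * int k * int L"
  proof -
    have "1 * 1 \<le> int k * int L" "1 * int L \<le> int k * int L" using k L by (intro mult_mono; simp)+
    then show ?thesis unfolding E_def distrib_right by linarith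
  qed
  then have "4 * int k * (E + 2) \<le> 4 * int k * (4 * int k * int L)" by (intro mult_left_mono) auto
  also have "\<dots> = int (16 * k\<^sup>2 * L)" by (simp add: power2_eq_square)
  also have "\<dots> \<le> int N" using N by (simp only: of_nat_le_iff)
  finally show ?thesis .
qed

lemma ctr_bounds: "int N - 2 * x - 4 * int k < 4 * int k * ctr x" "4 * int k * ctr x \<le> int N - 2 * x"
proof -
  have "0 < 4 * int k" using k by simp
  then show "int N - 2 * x - 4 * int k < 4 * int k * ctr x" "4 * int k * ctr x \<le> int N - 2 * x"
    using mult_div_mod_eq[of "4 * int k" "int N - 2 * x"] pos_mod_bound[of "4 * int k" "int N - 2 * x"]
      pos_mod_sign[of "4 * int k" "int N - 2 * x"] unfolding ctr_def by linarith+
qed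

text \<open>With \<open>s\<close> directions the vertex is about
  \<open>x + s * (N - 2 * x) / (4 * k)\<close>, a convex combination of \<open>x\<close> and
  \<open>N / 2\<close> with weight \<open>s / (2 * k)\<close> on the midpoint. Its distance from the
  ends is therefore about \<open>s * N / (4 * k)\<close> or more, which by \<open>E_bound\<close>
  exceeds the deviation \<open>s * (E + 1)\<close> due to the box and to rounding.\<close>

lemma box_vertices:
  assumes x: "x \<in> {1..int N}" and S: "S \<subseteq> {..<k}" and h: "\<And>i. i \<in> S \<Longrightarrow> h i \<in> U x"
  shows "x + sum h S \<in> {1..int N}"
proof (cases "S = {}")
  case False
  define s where "s = int (card S)"
  have fin: "finite S" using S finite_subset by auto
  have s: "1 \<le> s" "s \<le> int k"
    using False fin card_mono[OF _ S] by (auto simp: s_def Suc_le_eq card_gt_0_iff)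
  have lo: "s * (ctr x - E) \<le> sum h S"
    using sum_bounded_below[of S "ctr x - E" h] h by (auto simp: U_def s_def)
  have hi: "sum h S \<le> s * (ctr x + E)"
    using sum_bounded_above[of S h "ctr x + E"] h by (auto simp: U_def s_def)
  have K: "0 < 4 * int k" using k by simp
  have "4 * int k * 1 \<le> s * (4 * int k)" using s K by simp
  also have "\<dots> \<le> s * (int N - 4 * int k * (E + 1))"
    using s E_bound by (intro mult_left_mono) (auto simp: algebra_simps)
  also have "\<dots> \<le> x * (4 * int k - 2 * s) + s * (int N - 4 * int k * (E + 1))"
    using x s by simp
  also have "\<dots> = 4 * int k * x + s * ((int N - 2 * x - 4 * int k) - 4 * int k * E)"
    by (simp add: algebra_simps)
  also have "\<dots> \<le> 4 * int k * x + s * (4 * int k * ctr x - 4 * int k * E)"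
    using s ctr_bounds(1)[of x] by (intro add_mono mult_left_mono) auto
  also have "\<dots> = 4 * int k * (x + s * (ctr x - E))" by (simp add: algebra_simps)
  finally have 1: "1 \<le> x + s * (ctr x - E)" using K by (simp only: mult_le_cancel_left_pos)
  have "4 * int k * (x + s * (ctr x + E)) = 4 * int k * x + s * (4 * int k * ctr x + 4 * int k * E)"
    by (simp add: algebra_simps)
  also have "\<dots> \<le> 4 * int k * x + s * (int N - 2 * x + 4 * int k * E)"
    using s ctr_bounds(2)[of x] by (intro add_mono mult_left_mono) auto
  also have "\<dots> = 4 * int k * int N - (int N - x) * (4 * int k - 2 * s) - s * (int N - 4 * int k * E)"
    by (simp add: algebra_simps)
  also have "\<dots> \<le> 4 * int k * int N"
  proof -
    have "0 \<le> (int N - x) * (4 * int k - 2 * s)" using x s by simp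
    moreover have "0 \<le> s * (int N - 4 * int k * E)" using s E_bound by (simp add: algebra_simps)
    ultimately show ?thesis by linarith
  qed
  finally have 2: "x + s * (ctr x + E) \<le> int N" using K by (simp only: mult_le_cancel_left_pos)
  show ?thesis using 1 2 lo hi by simp
qed (use x in simp)

text \<open>The threshold allows \<kappa> for each of the \<open>k\<close> coordinates that must be
  changed to pass from one direction vector to the other.\<close>

definition disagree :: "int \<Rightarrow> (nat \<Rightarrow> int) \<Rightarrow> (nat \<Rightarrow> int) set" where
  "disagree x h' = {h \<in> Box x. real k * \<kappa> < nint_dist (cube_diff {..<k} F x h' - cube_diff {..<k} F x h)}"

text \<open>Consecutive hybrids differ in direction \<open>j\<close> only, so the difference of
  their votes is the difference over one cube based at \<open>x + h j\<close>, all of whose vertices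
  are vertices of box cubes at \<open>x\<close>. That cube determines \<open>h j\<close>,
  \<open>h' j\<close> and the other coordinates used by the hybrid; recording the
  \<open>k - 1\<close> coordinates it does not see makes the map injective.\<close>

lemma card_hybrid_le:
  assumes x: "x \<in> {1..int N}" and j: "j < k"
  shows "card {(h', h) \<in> Box x \<times> Box x.
      \<kappa> < nint_dist (cube_diff {..<k} F x (\<lambda>i. if i < Suc j then h' i else h i)
            - cube_diff {..<k} F x (\<lambda>i. if i < j then h' i else h i))} \<le> card bad * H ^ (k - 1)"
    (is "card ?P \<le> _")
proof -
  let ?g = "\<lambda>h' h i. if i < j then h' i else h i :: int"
  define dir where "dir h' h = (?g h' h)(j := h' j - h j)" for h' h :: "nat \<Rightarrow> int"
  define \<phi> where "\<phi> = (\<lambda>(h', h). ((x + h j, restrict (dir h' h) {..<k}),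
    restrict (\<lambda>i. if i < j then h i else h' i) ({..<k} - {j})))"
  have "inj_on \<phi> ?P"
  proof (intro inj_onI, clarify)
    fix a' a b' b
    assume ab: "a \<in> Box x" "a' \<in> Box x" "b \<in> Box x" "b' \<in> Box x" and eq: "\<phi> (a', a) = \<phi> (b', b)"
    have base: "a j = b j" using eq by (simp add: \<phi>_def)
    have d: "dir a' a i = dir b' b i" if "i < k" for i
    proof -
      have "restrict (dir a' a) {..<k} = restrict (dir b' b) {..<k}" using eq by (simp add: \<phi>_def)
      from fun_cong[OF this, of i] show ?thesis using that by simp
    qed
    have r: "(if i < j then a i else a' i) = (if i < j then b i else b' i)" if "i < k" "i \<noteq> j" for i
    proof -
      have "restrict (\<lambda>i. if i < j then a i else a' i) ({..<k} - {j})
        = restrict (\<lambda>i. if i < j then b i else b' i) ({..<k} - {j})" using eq by (simp add: \<phi>_def)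
      from fun_cong[OF this, of i] show ?thesis using that by simp
    qed
    have "a i = b i \<and> a' i = b' i" if "i < k" for i
    proof (cases "i = j")
      case True
      then show ?thesis using base d[OF that] by (simp add: dir_def)
    next
      case False
      then show ?thesis using r[OF that False] d[OF that] by (simp add: dir_def split: if_splits)
    qed
    then show "a' = b' \<and> a = b" using ab unfolding Box_def by (intro conjI PiE_ext) auto
  qed
  moreover have "\<phi> ` ?P \<subseteq> bad \<times> PiE ({..<k} - {j}) (\<lambda>_. U x)"
  proof (intro subsetI, elim imageE, clarify)
    fix y b r h' h assume h: "h' \<in> Box x" "h \<in> Box x" and eq: "((y, b), r) = \<phi> (h', h)"
      and gt: "\<kappa> < nint_dist (cube_diff {..<k} F x (\<lambda>i. if i < Suc j then h' i else h i)
            - cube_diff {..<k} F x (\<lambda>i. if i < j then h' i else h i))"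
    have hU: "h i \<in> U x" "h' i \<in> U x" if "i < k" for i using h that by (auto simp: Box_def)
    have "(x + h j, restrict (dir h' h) {..<k}) \<in> bad"
    proof (rule badI)
      fix S assume S: "S \<subseteq> {..<k}"
      have fin: "finite S" using S finite_subset by auto
      show "x + h j + sum (dir h' h) S \<in> {1..int N}"
      proof (cases "j \<in> S")
        case True
        have "h j + sum (dir h' h) S = sum ((?g h' h)(j := h' j)) S"
        proof -
          have "sum (dir h' h) (S - {j}) = sum (?g h' h) (S - {j})"
            "sum ((?g h' h)(j := h' j)) (S - {j}) = sum (?g h' h) (S - {j})"
            unfolding dir_def by (intro sum.cong; simp)+
          then show ?thesis
            using sum.remove[OF fin True, of "dir h' h"] sum.remove[OF fin True, of "(?g h' h)(j := h' j)"]
            by (simp add: dir_def)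
        qed
        moreover have "x + sum ((?g h' h)(j := h' j)) S \<in> {1..int N}"
          using hU S by (intro box_vertices x) auto
        ultimately show ?thesis by (simp add: add.assoc)
      next
        case False
        have "h j + sum (dir h' h) S = sum (?g h' h) (insert j S)"
        proof -
          have "sum (dir h' h) S = sum (?g h' h) S" using False unfolding dir_def by (intro sum.cong) auto
          then show ?thesis using fin False by simp
        qed
        moreover have "x + sum (?g h' h) (insert j S) \<in> {1..int N}"
          using hU S j by (intro box_vertices x) auto
        ultimately show ?thesis by (simp add: add.assoc)
      qed
    next
      have "(\<lambda>i. if i < Suc j then h' i else h i) = (?g h' h)(j := h' j)"
        by (auto simp: less_Suc_eq)
      moreover have "cube_diff {..<k} F x ((?g h' h)(j := h' j)) - cube_diff {..<k} F x (?g h' h)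
          = cube_diff {..<k} F (x + h j) (dir h' h)"
        using cube_diff_upd_minus[of "{..<k}" j F x "?g h' h" "h' j"] j by (simp add: dir_def)
      ultimately show "\<kappa> < nint_dist (cube_diff {..<k} F (x + h j) (dir h' h))" using gt by simp
    qed
    moreover have "restrict (\<lambda>i. if i < j then h i else h' i) ({..<k} - {j})
        \<in> PiE ({..<k} - {j}) (\<lambda>_. U x)" using hU by (simp add: PiE_def Pi_def)
    ultimately show "(y, b) \<in> bad \<and> r \<in> PiE ({..<k} - {j}) (\<lambda>_. U x)" using eq by (simp add: \<phi>_def)
  qed
  moreover have "finite (bad \<times> PiE ({..<k} - {j}) (\<lambda>_. U x))"
    using finite_bad finite_U by (intro finite_cartesian_product finite_PiE) auto
  ultimately have "card ?P \<le> card (bad \<times> PiE ({..<k} - {j}) (\<lambda>_. U x))" by (rule card_inj_on_le)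
  also have "\<dots> = card bad * H ^ (k - 1)"
    using j by (simp add: card_cartesian_product card_PiE card_U)
  finally show ?thesis .
qed

text \<open>A disagreeing pair must jump by more than \<kappa> at one of the \<open>k\<close> hybrid
  steps, so there are at most \<open>k * card bad * H ^ (k - 1)\<close> such pairs. Some
  \<open>h'\<close> among the \<open>H ^ k\<close> candidates does no worse than the
  average.\<close>

lemma ex_representative:
  assumes x: "x \<in> {1..int N}"
  shows "\<exists>h'\<in>Box x. H * card (disagree x h') \<le> k * card bad"
proof -
  let ?V = "cube_diff {..<k} F x"
  let ?g = "\<lambda>h' h j i. if i < j then h' i else h i :: int"
  let ?P = "\<lambda>j. {(h', h) \<in> Box x \<times> Box x. \<kappa> < nint_dist (?V (?g h' h (Suc j)) - ?V (?g h' h j))}"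
  have finP: "finite (?P j)" for j
    using finite_Box by (intro finite_subset[of "?P j" "Box x \<times> Box x"]) auto
  have sub: "Sigma (Box x) (disagree x) \<subseteq> (\<Union>j<k. ?P j)"
  proof clarify
    fix h' h assume h': "h' \<in> Box x" and h: "h \<in> disagree x h'"
    show "(h', h) \<in> (\<Union>j<k. ?P j)"
    proof (rule ccontr)
      assume "(h', h) \<notin> (\<Union>j<k. ?P j)"
      then have le: "nint_dist (?V (?g h' h (Suc j)) - ?V (?g h' h j)) \<le> \<kappa>" if "j < k" for j
        using h' h that by (force simp: disagree_def)
      have "?V h' - ?V h = ?V (?g h' h k) - ?V (?g h' h 0)"
        by (intro arg_cong2[where f = "(-)"] cube_diff_cong) auto
      also have "\<dots> = (\<Sum>j<k. ?V (?g h' h (Suc j)) - ?V (?g h' h j))"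
        by (rule sum_lessThan_telescope[symmetric])
      finally have "?V h' - ?V h = (\<Sum>j<k. ?V (?g h' h (Suc j)) - ?V (?g h' h j))" .
      then have "nint_dist (?V h' - ?V h) \<le> (\<Sum>j<k. nint_dist (?V (?g h' h (Suc j)) - ?V (?g h' h j)))"
        by (simp only: nint_dist_sum)
      also have "\<dots> \<le> real k * \<kappa>"
        using sum_bounded_above[of "{..<k}" "\<lambda>j. nint_dist (?V (?g h' h (Suc j)) - ?V (?g h' h j))" \<kappa>] le by simp
      finally show False using h by (simp add: disagree_def)
    qed
  qed
  have "(\<Sum>h'\<in>Box x. card (disagree x h')) = card (Sigma (Box x) (disagree x))"
    using finite_Box by (subst card_SigmaI) (auto simp: disagree_def)
  also have "\<dots> \<le> card (\<Union>j<k. ?P j)" using sub finP by (intro card_mono finite_UN_I) auto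
  also have "\<dots> \<le> (\<Sum>j<k. card (?P j))" by (intro card_UN_le) simp
  also have "\<dots> \<le> (\<Sum>j<k. card bad * H ^ (k - 1))" by (intro sum_mono card_hybrid_le x) simp
  finally have *: "(\<Sum>h'\<in>Box x. card (disagree x h')) \<le> k * card bad * H ^ (k - 1)"
    by (simp add: mult.assoc)
  have H: "1 \<le> H" using L L_le_H by simp
  have "0 < card (Box x)" using H by (simp add: card_Box)
  then have "Box x \<noteq> {}" by auto
  with ex_le_average[OF finite_Box this, of "\<lambda>h'. card (disagree x h')"]
  obtain h' where h': "h' \<in> Box x" "H ^ k * card (disagree x h') \<le> k * card bad * H ^ (k - 1)"
    using * by (auto simp: card_Box intro: order_trans)
  have "H ^ k = H * H ^ (k - 1)" using k by (simp flip: power_Suc)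
  then have "H ^ (k - 1) * (H * card (disagree x h')) \<le> H ^ (k - 1) * (k * card bad)"
    using h' by (simp add: mult_ac)
  moreover have "0 < H ^ (k - 1)" using H by simp
  ultimately show ?thesis using h'(1) nat_mult_le_cancel1 by blast
qed

end

section \<open>The corrected function and its distance from \<open>F\<close>\<close>

context self_correction
begin

text \<open>The representative is a direction whose vote for the value at \<open>x\<close> agrees with most other votes; \<open>corrected x\<close> is
  the value voted for, since \<open>cube_diff {..<k} F x h\<close> has the summand \<open>F x\<close>.\<close>

definition rep :: "int \<Rightarrow> nat \<Rightarrow> int" where
  "rep x = (SOME h'. h' \<in> Box x \<and> H * card (disagree x h') \<le> k * card bad)"

definition corrected :: "int \<Rightarrow> real" where
  "corrected x = F x - cube_diff {..<k} F x (rep x)"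

lemma rep:
  assumes "x \<in> {1..int N}"
  shows "rep x \<in> Box x" "H * card (disagree x (rep x)) \<le> k * card bad"
  using someI_ex[of "\<lambda>h'. h' \<in> Box x \<and> H * card (disagree x h') \<le> k * card bad"]
    ex_representative[OF assms] by (auto simp: rep_def)

lemma finite_disagree: "finite (disagree x h')"
  using finite_Box by (simp add: disagree_def)

lemma Box_cubes:
  assumes x: "x \<in> {1..int N}" and h: "h \<in> Box x"
  shows "(x, h) \<in> cubes k N"
  using h box_vertices[OF x] by (auto simp: cubes_def Box_def PiE_iff)

text \<open>At a far point every box direction either gives a bad cube or disagrees with the
  representative, since otherwise the two tolerances \<kappa> and \<open>k * \<kappa>\<close> would
  add up to a near value. The smallness assumption limits disagreement to half the box, so at least
  half of the box cubes at such a point are bad. Summing over the far points counts each bad cube at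
  most once.\<close>

lemma card_far_le:
  assumes small: "2 * k * card bad \<le> L ^ (k + 1)"
  shows "card {x \<in> {1..int N}. (real k + 1) * \<kappa> < nint_dist (F x - corrected x)} * L ^ k \<le> 2 * card bad"
    (is "card ?X * _ \<le> _")
proof -
  let ?B = "\<lambda>x. {h \<in> Box x. (x, h) \<in> bad}"
  have "H ^ k \<le> 2 * card (?B x)" if "x \<in> ?X" for x
  proof -
    have x: "x \<in> {1..int N}" and far: "(real k + 1) * \<kappa> < nint_dist (cube_diff {..<k} F x (rep x))"
      using that by (auto simp: corrected_def)
    have "Box x \<subseteq> ?B x \<union> disagree x (rep x)"
    proof
      fix h assume h: "h \<in> Box x"
      show "h \<in> ?B x \<union> disagree x (rep x)"
      proof (rule ccontr)
        assume not: "h \<notin> ?B x \<union> disagree x (rep x)"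
        then have "nint_dist (cube_diff {..<k} F x h) \<le> \<kappa>"
          using Box_cubes[OF x h] h by (auto simp: bad_def)
        moreover have "nint_dist (cube_diff {..<k} F x (rep x) - cube_diff {..<k} F x h) \<le> real k * \<kappa>"
          using not h by (auto simp: disagree_def)
        ultimately show False
          using far nint_dist_add[of "cube_diff {..<k} F x (rep x) - cube_diff {..<k} F x h" "cube_diff {..<k} F x h"]
          by (simp add: distrib_right)
      qed
    qed
    then have "card (Box x) \<le> card (?B x \<union> disagree x (rep x))"
      using finite_Box finite_disagree by (intro card_mono) auto
    also have "\<dots> \<le> card (?B x) + card (disagree x (rep x))" by (rule card_Un_le)
    finally have *: "H ^ k \<le> card (?B x) + card (disagree x (rep x))" by (simp add: card_Box)
    have "H * (2 * card (disagree x (rep x))) \<le> 2 * k * card bad" using rep(2)[OF x] by simp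
    also have "\<dots> \<le> L ^ (k + 1)" by (rule small)
    also have "\<dots> \<le> H ^ (k + 1)" using L_le_H by (rule power_mono) simp
    also have "\<dots> = H * H ^ k" by simp
    finally have "2 * card (disagree x (rep x)) \<le> H ^ k"
      using L L_le_H nat_mult_le_cancel1[of H] by simp
    then show ?thesis using * by simp
  qed
  then have "(\<Sum>x\<in>?X. H ^ k) \<le> (\<Sum>x\<in>?X. 2 * card (?B x))" by (intro sum_mono)
  then have "card ?X * H ^ k \<le> 2 * (\<Sum>x\<in>?X. card (?B x))" by (simp add: sum_distrib_left)
  also have "(\<Sum>x\<in>?X. card (?B x)) = card (Sigma ?X ?B)"
    using finite_Box by (intro card_SigmaI[symmetric] finite_Collect_conjI) auto
  also have "\<dots> \<le> card bad" using finite_bad by (intro card_mono) auto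
  finally have "card ?X * H ^ k \<le> 2 * card bad" by simp
  moreover have "card ?X * L ^ k \<le> card ?X * H ^ k"
    by (intro mult_left_mono power_mono L_le_H) auto
  ultimately show ?thesis by (rule order.trans[rotated])
qed

section \<open>Differences of the corrected function over an arbitrary cube in
  \<open>[N]\<close>\<close>

context
  fixes x :: int and t :: "nat \<Rightarrow> int"
  assumes xt: "\<And>S. S \<subseteq> {..<k} \<Longrightarrow> x + sum t S \<in> {1..int N}"
begin

definition W :: "(nat \<times> nat \<Rightarrow> int) set" where
  "W = PiE ({..<k} \<times> {..k}) (\<lambda>_. {0..<int L})"

text \<open>The directions \<open>tilt \<omega> w\<close> are affine in \<open>\<omega>\<close> and follow the moving box of \<open>x + sum t \<omega>\<close>. Hence, for fixed
  nonempty \<open>\<sigma>\<close>, the points \<open>x + sum t \<omega> + sum (tilt \<omega> w) \<sigma>\<close> form again a cube as \<open>\<omega>\<close> varies, and the noise \<open>w\<close>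
  equidistributes that cube. The entries \<open>w (i, k)\<close> perturb the constant term.\<close>

definition slope :: "nat \<Rightarrow> int" where "slope j = (- t j) div (2 * int k)"

definition tilt :: "nat set \<Rightarrow> (nat \<times> nat \<Rightarrow> int) \<Rightarrow> nat \<Rightarrow> int" where
  "tilt \<omega> w i = ctr x + w (i, k) + (\<Sum>j\<in>\<omega>. slope j + w (i, j))"

definition face_base :: "nat set \<Rightarrow> (nat \<times> nat \<Rightarrow> int) \<Rightarrow> int" where
  "face_base \<sigma> w = x + (\<Sum>i\<in>\<sigma>. ctr x + w (i, k))"

definition face_dir :: "nat set \<Rightarrow> (nat \<times> nat \<Rightarrow> int) \<Rightarrow> nat \<Rightarrow> int" where
  "face_dir \<sigma> w j = t j + (\<Sum>i\<in>\<sigma>. slope j + w (i, j))"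

lemma finite_W: "finite W" unfolding W_def by (intro finite_PiE) auto

lemma card_W: "card W = L ^ (k * (k + 1))"
  unfolding W_def by (simp add: card_PiE card_cartesian_product)

text \<open>The summed tilts form a double sum over \<open>\<omega> \<times> \<sigma>\<close>. Read
  with \<omega> fixed, it is a vertex of the cube voting at \<open>x + sum t \<omega>\<close>; read
  with \<sigma> fixed, it is a vertex of a cube in the variable \<omega>.\<close>

lemma face_vertex:
  "face_base \<sigma> w + sum (face_dir \<sigma> w) \<omega> = x + sum t \<omega> + sum (tilt \<omega> w) \<sigma>"
proof -
  have "(\<Sum>j\<in>\<omega>. \<Sum>i\<in>\<sigma>. slope j + w (i, j)) = (\<Sum>i\<in>\<sigma>. \<Sum>j\<in>\<omega>. slope j + w (i, j))"
    by (rule sum.swap)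
  then show ?thesis
    by (simp add: face_base_def face_dir_def tilt_def sum.distrib)
qed

text \<open>\<open>slope j\<close> is the rounded change of \<open>(N - 2 * x) / (4 * k)\<close>
  when \<open>x\<close> moves by \<open>t j\<close>. Rounding leaves an integer error
  \<open>d\<close> with \<open>- k \<le> d \<le> 0\<close>, and at most \<open>k + 1\<close> noise
  terms contribute between 0 and \<open>(k + 1) * L = E\<close>; both fit into the half-width
  because \<open>k \<le> E\<close>.\<close>

lemma tilt_in_U:
  assumes w: "w \<in> W" and i: "i < k" and \<omega>: "\<omega> \<subseteq> {..<k}"
  shows "tilt \<omega> w i \<in> U (x + sum t \<omega>)"
proof -
  have K: "0 < 4 * int k" "0 < 2 * int k" using k by auto
  have fin: "finite \<omega>" using \<omega> finite_subset by auto
  have c: "card \<omega> \<le> k" using card_mono[OF _ \<omega>] by simp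
  have sl: "- t j - 2 * int k \<le> 2 * int k * slope j \<and> 2 * int k * slope j \<le> - t j" for j
    using mult_div_mod_eq[of "2 * int k" "- t j"] pos_mod_bound[OF K(2), of "- t j"]
      pos_mod_sign[OF K(2), of "- t j"] unfolding slope_def by linarith
  have "2 * int k * sum slope \<omega> \<le> (\<Sum>j\<in>\<omega>. - t j)"
    unfolding sum_distrib_left using sl by (intro sum_mono) auto
  then have up: "4 * int k * sum slope \<omega> \<le> - 2 * sum t \<omega>" by (simp add: sum_negf)
  have "(\<Sum>j\<in>\<omega>. - t j - 2 * int k) \<le> 2 * int k * sum slope \<omega>"
    unfolding sum_distrib_left using sl by (intro sum_mono) auto
  then have "- 2 * sum t \<omega> - 4 * int k * int (card \<omega>) \<le> 4 * int k * sum slope \<omega>"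
    by (simp add: sum_subtractf sum_negf algebra_simps)
  moreover have "4 * int k * int (card \<omega>) \<le> 4 * int k * int k" using c by (intro mult_left_mono) auto
  ultimately have lo: "- 2 * sum t \<omega> - 4 * int k * int k \<le> 4 * int k * sum slope \<omega>" by linarith
  define d where "d = ctr x + sum slope \<omega> - ctr (x + sum t \<omega>)"
  have d4: "4 * int k * d = 4 * int k * ctr x + 4 * int k * sum slope \<omega> - 4 * int k * ctr (x + sum t \<omega>)"
    by (simp add: d_def algebra_simps)
  have "4 * int k * d < 4 * int k * 1"
    using d4 up ctr_bounds[of x] ctr_bounds[of "x + sum t \<omega>"] by simp
  then have d1: "d < 1" using K by (simp only: mult_less_cancel_left_pos)
  have "4 * int k * (- int k - 1) < 4 * int k * d"
    using d4 lo ctr_bounds[of x] ctr_bounds[of "x + sum t \<omega>"] by (simp add: algebra_simps)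
  then have d2: "- int k - 1 < d" using K by (simp only: mult_less_cancel_left_pos)
  define s where "s = w (i, k) + (\<Sum>j\<in>\<omega>. w (i, j))"
  have w01: "0 \<le> w (i, j) \<and> w (i, j) \<le> int L" if "j \<le> k" for j
    using w i that unfolding W_def by (force simp: PiE_iff)
  have s1: "0 \<le> s" unfolding s_def using w01 \<omega> by (intro add_nonneg_nonneg sum_nonneg) auto
  have "(\<Sum>j\<in>\<omega>. w (i, j)) \<le> int (card \<omega>) * int L"
    using sum_bounded_above[of \<omega> "\<lambda>j. w (i, j)" "int L"] w01 \<omega> by force
  also have "\<dots> \<le> int k * int L" using c by (intro mult_right_mono) auto
  finally have s2: "s \<le> E" using w01[of k] unfolding s_def E_def distrib_right by simp
  have "int k * 1 \<le> int k * int L" using L by (intro mult_left_mono) auto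
  then have kE: "int k \<le> E" unfolding E_def distrib_right by simp
  have "tilt \<omega> w i = ctr (x + sum t \<omega>) + d + s"
    by (simp add: tilt_def d_def s_def sum.distrib)
  then show ?thesis using s1 s2 d1 d2 kE by (simp add: U_def)
qed

definition bad_face :: "nat set \<Rightarrow> (nat \<times> nat \<Rightarrow> int) set" where
  "bad_face \<sigma> = {w \<in> W. \<kappa> < nint_dist (cube_diff {..<k} F (face_base \<sigma> w) (face_dir \<sigma> w))}"

text \<open>Fix \<open>i0\<close> in \<sigma>. With all other rows of \<open>w\<close> fixed, the
  \<open>k + 1\<close> entries of row \<open>i0\<close> translate the base and each of the
  \<open>k\<close> directions independently, so they can be recovered from the cube. The other
  \<open>(k - 1) * (k + 1)\<close> entries are recorded separately. For empty \<sigma> no noise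
  would enter.\<close>

lemma card_bad_face_le:
  assumes \<sigma>: "\<sigma> \<subseteq> {..<k}" "\<sigma> \<noteq> {}"
  shows "card (bad_face \<sigma>) \<le> card bad * L ^ ((k - 1) * (k + 1))"
proof -
  obtain i0 where i0: "i0 \<in> \<sigma>" using \<sigma> by blast
  have fin: "finite \<sigma>" using \<sigma> finite_subset by auto
  let ?J = "({..<k} - {i0}) \<times> {..k}"
  define \<phi> where "\<phi> w = ((face_base \<sigma> w, restrict (face_dir \<sigma> w) {..<k}), restrict w ?J)"
    for w :: "nat \<times> nat \<Rightarrow> int"
  have "inj_on \<phi> (bad_face \<sigma>)"
  proof (rule inj_onI)
    fix v w assume vw: "v \<in> bad_face \<sigma>" "w \<in> bad_face \<sigma>" and eq: "\<phi> v = \<phi> w"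
    have r: "v (i, j) = w (i, j)" if "i < k" "i \<noteq> i0" "j \<le> k" for i j
    proof -
      have "restrict v ?J = restrict w ?J" using eq by (simp add: \<phi>_def)
      from fun_cong[OF this, of "(i, j)"] show ?thesis using that by simp
    qed
    have rest: "(\<Sum>i\<in>\<sigma> - {i0}. c + v (i, j)) = (\<Sum>i\<in>\<sigma> - {i0}. c + w (i, j))" if "j \<le> k" for j c
      using that \<sigma> by (intro sum.cong refl) (auto simp: r)
    have "v (i0, k) = w (i0, k)"
    proof -
      have "face_base \<sigma> v = face_base \<sigma> w" using eq by (simp add: \<phi>_def)
      then show ?thesis unfolding face_base_def sum.remove[OF fin i0] rest[OF order_refl] by simp
    qed
    moreover have "v (i0, j) = w (i0, j)" if "j < k" for j
    proof -
      have "restrict (face_dir \<sigma> v) {..<k} = restrict (face_dir \<sigma> w) {..<k}" using eq by (simp add: \<phi>_def)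
      from fun_cong[OF this, of j] have "face_dir \<sigma> v j = face_dir \<sigma> w j" using that by simp
      then show ?thesis
        unfolding face_dir_def sum.remove[OF fin i0] rest[OF less_imp_le[OF that]] by simp
    qed
    ultimately have all: "v (i, j) = w (i, j)" if "i < k" "j \<le> k" for i j
      using r that by (cases "i = i0"; cases "j = k") auto
    have "v \<in> W" "w \<in> W" using vw by (auto simp: bad_face_def)
    then show "v = w" unfolding W_def by (rule PiE_ext) (auto simp: all)
  qed
  moreover have "\<phi> ` bad_face \<sigma> \<subseteq> bad \<times> PiE ?J (\<lambda>_. {0..<int L})"
  proof (intro image_subsetI)
    fix w assume w: "w \<in> bad_face \<sigma>"
    then have wW: "w \<in> W" by (simp add: bad_face_def)
    have "(face_base \<sigma> w, restrict (face_dir \<sigma> w) {..<k}) \<in> bad"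
    proof (rule badI)
      fix S assume S: "S \<subseteq> {..<k}"
      show "face_base \<sigma> w + sum (face_dir \<sigma> w) S \<in> {1..int N}"
        unfolding face_vertex using \<sigma> S wW by (intro box_vertices xt tilt_in_U) auto
    qed (use w in \<open>simp add: bad_face_def\<close>)
    moreover have "restrict w ?J \<in> PiE ?J (\<lambda>_. {0..<int L})"
      using wW by (intro restrict_PiE_iff[THEN iffD2] ballI) (force simp: W_def PiE_iff)
    ultimately show "\<phi> w \<in> bad \<times> PiE ?J (\<lambda>_. {0..<int L})" by (simp add: \<phi>_def)
  qed
  moreover have "finite (bad \<times> PiE ?J (\<lambda>_. {0..<int L}))"
    using finite_bad by (intro finite_cartesian_product finite_PiE) auto
  ultimately have "card (bad_face \<sigma>) \<le> card (bad \<times> PiE ?J (\<lambda>_. {0..<int L}))" by (rule card_inj_on_le)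
  also have "\<dots> = card bad * L ^ ((k - 1) * (k + 1))"
    using i0 \<sigma> by (simp add: card_cartesian_product card_PiE subset_iff)
  finally show ?thesis .
qed

definition bad_tilt :: "nat set \<Rightarrow> (nat \<times> nat \<Rightarrow> int) set" where
  "bad_tilt \<omega> = {w \<in> W. restrict (tilt \<omega> w) {..<k} \<in> disagree (x + sum t \<omega>) (rep (x + sum t \<omega>))}"

text \<open>With the entries \<open>w (i, j)\<close> for \<open>j < k\<close> fixed, the entries
  \<open>w (i, k)\<close> translate the coordinates of the tilt one by one, so each disagreeing
  direction vector arises at most once for each choice of the \<open>k * k\<close> fixed
  entries.\<close>

lemma card_bad_tilt_le:
  assumes \<omega>: "\<omega> \<subseteq> {..<k}"
  shows "card (bad_tilt \<omega>) \<le> card (disagree (x + sum t \<omega>) (rep (x + sum t \<omega>))) * L ^ (k * k)"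
    (is "_ \<le> card ?D * _")
proof -
  let ?J = "{..<k} \<times> {..<k}"
  define \<phi> where "\<phi> w = (restrict (tilt \<omega> w) {..<k}, restrict w ?J)" for w :: "nat \<times> nat \<Rightarrow> int"
  have "inj_on \<phi> (bad_tilt \<omega>)"
  proof (rule inj_onI)
    fix v w assume vw: "v \<in> bad_tilt \<omega>" "w \<in> bad_tilt \<omega>" and eq: "\<phi> v = \<phi> w"
    have r: "v (i, j) = w (i, j)" if "i < k" "j < k" for i j
    proof -
      have "restrict v ?J = restrict w ?J" using eq by (simp add: \<phi>_def)
      from fun_cong[OF this, of "(i, j)"] show ?thesis using that by simp
    qed
    have "v (i, k) = w (i, k)" if i: "i < k" for i
    proof -
      have "restrict (tilt \<omega> v) {..<k} = restrict (tilt \<omega> w) {..<k}" using eq by (simp add: \<phi>_def)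
      from fun_cong[OF this, of i] have "tilt \<omega> v i = tilt \<omega> w i" using i by simp
      moreover have "(\<Sum>j\<in>\<omega>. slope j + v (i, j)) = (\<Sum>j\<in>\<omega>. slope j + w (i, j))"
        using \<omega> i by (intro sum.cong refl) (auto simp: r)
      ultimately show ?thesis by (simp add: tilt_def)
    qed
    with r have all: "v (i, j) = w (i, j)" if "i < k" "j \<le> k" for i j
      using that by (cases "j = k") auto
    have "v \<in> W" "w \<in> W" using vw by (auto simp: bad_tilt_def)
    then show "v = w" unfolding W_def by (rule PiE_ext) (auto simp: all)
  qed
  moreover have "\<phi> ` bad_tilt \<omega> \<subseteq> ?D \<times> PiE ?J (\<lambda>_. {0..<int L})"
  proof (intro image_subsetI)
    fix w assume w: "w \<in> bad_tilt \<omega>"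
    then have "restrict w ?J \<in> PiE ?J (\<lambda>_. {0..<int L})"
      by (intro restrict_PiE_iff[THEN iffD2] ballI) (force simp: bad_tilt_def W_def PiE_iff)
    then show "\<phi> w \<in> ?D \<times> PiE ?J (\<lambda>_. {0..<int L})"
      using w by (simp add: bad_tilt_def \<phi>_def)
  qed
  moreover have "finite (?D \<times> PiE ?J (\<lambda>_. {0..<int L}))"
    using finite_disagree by (intro finite_cartesian_product finite_PiE) auto
  ultimately have "card (bad_tilt \<omega>) \<le> card (?D \<times> PiE ?J (\<lambda>_. {0..<int L}))" by (rule card_inj_on_le)
  then show ?thesis by (simp add: card_cartesian_product card_PiE)
qed

text \<open>A union bound, multiplied by \<open>L\<close> to clear denominators: the faces
  contribute at most \<open>2 ^ k * card bad * L ^ (k * k)\<close> and the tilts \<open>k\<close>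
  times as much. Together this stays below \<open>L * card W = L ^ (k + 1) * L ^ (k * k)\<close>
  exactly when the hypothesis \<open>small\<close> holds.\<close>

lemma ex_good_tilt:
  assumes small: "2 ^ k * (k + 1) * card bad < L ^ (k + 1)"
  obtains w where "w \<in> W" "\<And>\<sigma>. \<sigma> \<subseteq> {..<k} \<Longrightarrow> \<sigma> \<noteq> {} \<Longrightarrow> w \<notin> bad_face \<sigma>"
    "\<And>\<omega>. \<omega> \<subseteq> {..<k} \<Longrightarrow> w \<notin> bad_tilt \<omega>"
proof -
  have "\<not> W \<subseteq> (\<Union>\<sigma>\<in>Pow {..<k} - {{}}. bad_face \<sigma>) \<union> (\<Union>\<omega>\<in>Pow {..<k}. bad_tilt \<omega>)" (is "\<not> W \<subseteq> ?A \<union> ?B")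
  proof
    assume sub: "W \<subseteq> ?A \<union> ?B"
    have fin: "finite (?A \<union> ?B)"
      using finite_W by (intro finite_subset[of "?A \<union> ?B" W]) (auto simp: bad_face_def bad_tilt_def)
    have "L * card ?A \<le> L * (\<Sum>\<sigma>\<in>Pow {..<k} - {{}}. card (bad_face \<sigma>))"
      by (intro mult_left_mono card_UN_le) auto
    also have "\<dots> \<le> L * (\<Sum>\<sigma>\<in>Pow {..<k} - {{}}. card bad * L ^ ((k - 1) * (k + 1)))"
      by (intro mult_left_mono sum_mono card_bad_face_le) auto
    also have "\<dots> \<le> L * (\<Sum>\<sigma>\<in>Pow {..<k}. card bad * L ^ ((k - 1) * (k + 1)))"
      by (intro mult_left_mono sum_mono2) auto
    also have "\<dots> = 2 ^ k * card bad * L ^ (1 + (k - 1) * (k + 1))" by (simp add: card_Pow)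
    also have "1 + (k - 1) * (k + 1) = k * k" using k by (cases k) simp_all
    finally have A: "L * card ?A \<le> 2 ^ k * card bad * L ^ (k * k)" .
    have "L * card ?B \<le> L * (\<Sum>\<omega>\<in>Pow {..<k}. card (bad_tilt \<omega>))"
      by (intro mult_left_mono card_UN_le) auto
    also have "\<dots> = (\<Sum>\<omega>\<in>Pow {..<k}. L * card (bad_tilt \<omega>))" by (simp add: sum_distrib_left)
    also have "\<dots> \<le> (\<Sum>\<omega>\<in>Pow {..<k}. k * card bad * L ^ (k * k))"
    proof (intro sum_mono)
      fix \<omega> assume "\<omega> \<in> Pow {..<k}"
      then have \<omega>: "\<omega> \<subseteq> {..<k}" by simp
      let ?D = "disagree (x + sum t \<omega>) (rep (x + sum t \<omega>))"
      have "L * card (bad_tilt \<omega>) \<le> H * (card ?D * L ^ (k * k))"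
        by (intro mult_mono L_le_H card_bad_tilt_le \<omega>) auto
      also have "\<dots> = (H * card ?D) * L ^ (k * k)" by simp
      also have "\<dots> \<le> k * card bad * L ^ (k * k)"
        by (intro mult_right_mono rep xt \<omega>) auto
      finally show "L * card (bad_tilt \<omega>) \<le> k * card bad * L ^ (k * k)" .
    qed
    also have "\<dots> = 2 ^ k * k * card bad * L ^ (k * k)" by (simp add: card_Pow)
    finally have B: "L * card ?B \<le> 2 ^ k * k * card bad * L ^ (k * k)" .
    have "card W \<le> card ?A + card ?B"
      using card_mono[OF fin sub] card_Un_le[of ?A ?B] by simp
    then have "L * card W \<le> L * card ?A + L * card ?B" by (metis distrib_left mult_le_mono2)
    also have "\<dots> \<le> (2 ^ k * (k + 1) * card bad) * L ^ (k * k)" using A B by (simp add: algebra_simps)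
    also have "\<dots> < L ^ (k + 1) * L ^ (k * k)" using small L by (intro mult_strict_right_mono) auto
    also have "\<dots> = L * card W" by (simp add: card_W flip: power_add)
    finally show False by simp
  qed
  then obtain w where "w \<in> W" "w \<notin> ?A" "w \<notin> ?B" by blast
  then show ?thesis by (intro that[of w]) auto
qed

text \<open>In each vote the term of the empty \<sigma> is \<open>F\<close> itself and cancels.
  After the two sums are exchanged, only cubes with nonempty \<sigma> remain, which are those that
  the noise equidistributes.\<close>

lemma sum_tilt_identity:
  "(\<Sum>\<omega>\<in>Pow {..<k}. (-1) ^ card \<omega> * (F (x + sum t \<omega>) - cube_diff {..<k} F (x + sum t \<omega>) (tilt \<omega> w)))
    = (\<Sum>\<sigma>\<in>Pow {..<k} - {{}}. - ((-1) ^ card \<sigma> * cube_diff {..<k} F (face_base \<sigma> w) (face_dir \<sigma> w)))"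
proof -
  have *: "F y - cube_diff {..<k} F y h = - (\<Sum>\<sigma>\<in>Pow {..<k} - {{}}. (-1) ^ card \<sigma> * F (y + sum h \<sigma>))" for y h
    unfolding cube_diff_def by (subst sum.remove[of _ "{}"]) auto
  have "(\<Sum>\<omega>\<in>Pow {..<k}. (-1) ^ card \<omega> * (F (x + sum t \<omega>) - cube_diff {..<k} F (x + sum t \<omega>) (tilt \<omega> w)))
    = (\<Sum>\<omega>\<in>Pow {..<k}. \<Sum>\<sigma>\<in>Pow {..<k} - {{}}.
        - ((-1) ^ card \<sigma> * ((-1) ^ card \<omega> * F (x + sum t \<omega> + sum (tilt \<omega> w) \<sigma>))))"
    unfolding * by (simp add: sum_distrib_left sum_negf mult.left_commute)
  also have "\<dots> = (\<Sum>\<sigma>\<in>Pow {..<k} - {{}}. \<Sum>\<omega>\<in>Pow {..<k}.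
        - ((-1) ^ card \<sigma> * ((-1) ^ card \<omega> * F (x + sum t \<omega> + sum (tilt \<omega> w) \<sigma>))))"
    by (rule sum.swap)
  also have "\<dots> = (\<Sum>\<sigma>\<in>Pow {..<k} - {{}}.
        - ((-1) ^ card \<sigma> * cube_diff {..<k} F (face_base \<sigma> w) (face_dir \<sigma> w)))"
    unfolding cube_diff_def face_vertex by (simp add: sum_negf sum_distrib_left)
  finally show ?thesis .
qed

text \<open>Replacing the representative by the tilt costs \<open>k * \<kappa>\<close> at each of
  the \<open>2 ^ k\<close> vertices, and each good face costs \<kappa>. The noise exists for this
  particular cube, so the bound has no exceptional cubes.\<close>

lemma nint_dist_cube_diff_corrected_le:
  assumes small: "2 ^ k * (k + 1) * card bad < L ^ (k + 1)" and \<kappa>: "0 \<le> \<kappa>"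
  shows "nint_dist (cube_diff {..<k} corrected x t) \<le> 2 ^ k * (real k + 1) * \<kappa>"
proof -
  obtain w where w: "w \<in> W" and face: "\<And>\<sigma>. \<sigma> \<subseteq> {..<k} \<Longrightarrow> \<sigma> \<noteq> {} \<Longrightarrow> w \<notin> bad_face \<sigma>"
    and tilt: "\<And>\<omega>. \<omega> \<subseteq> {..<k} \<Longrightarrow> w \<notin> bad_tilt \<omega>"
    using ex_good_tilt[OF small] by blast
  let ?p = "\<lambda>\<omega>. x + sum t \<omega>"
  let ?V = "\<lambda>y. cube_diff {..<k} F y"
  let ?err = "\<lambda>\<omega>. ?V (?p \<omega>) (rep (?p \<omega>)) - ?V (?p \<omega>) (tilt \<omega> w)"
  have err: "nint_dist (?err \<omega>) \<le> real k * \<kappa>" if \<omega>: "\<omega> \<subseteq> {..<k}" for \<omega>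
  proof -
    have "restrict (tilt \<omega> w) {..<k} \<in> Box (?p \<omega>)"
      using tilt_in_U[OF w _ \<omega>] by (auto simp: Box_def)
    moreover have "?V (?p \<omega>) (restrict (tilt \<omega> w) {..<k}) = ?V (?p \<omega>) (tilt \<omega> w)"
      by (intro cube_diff_cong) auto
    ultimately show ?thesis using tilt[OF \<omega>] w by (auto simp: bad_tilt_def disagree_def)
  qed
  have eq: "cube_diff {..<k} corrected x t
      = (\<Sum>\<omega>\<in>Pow {..<k}. (-1) ^ card \<omega> * (F (?p \<omega>) - ?V (?p \<omega>) (tilt \<omega> w)))
        - (\<Sum>\<omega>\<in>Pow {..<k}. (-1) ^ card \<omega> * ?err \<omega>)"
    unfolding cube_diff_def[of _ corrected] corrected_def
    by (simp add: right_diff_distrib flip: sum_subtractf)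
  have "nint_dist (cube_diff {..<k} corrected x t)
      \<le> (\<Sum>\<sigma>\<in>Pow {..<k} - {{}}. \<kappa>) + (\<Sum>\<omega>\<in>Pow {..<k}. real k * \<kappa>)"
    unfolding eq sum_tilt_identity
  proof (rule order_trans[OF nint_dist_diff], rule add_mono)
    show "nint_dist (\<Sum>\<sigma>\<in>Pow {..<k} - {{}}. - ((-1) ^ card \<sigma> * ?V (face_base \<sigma> w) (face_dir \<sigma> w)))
        \<le> (\<Sum>\<sigma>\<in>Pow {..<k} - {{}}. \<kappa>)"
      using face w by (intro order_trans[OF nint_dist_sum] sum_mono) (auto simp: bad_face_def not_less)
    show "nint_dist (\<Sum>\<omega>\<in>Pow {..<k}. (-1) ^ card \<omega> * ?err \<omega>) \<le> (\<Sum>\<omega>\<in>Pow {..<k}. real k * \<kappa>)"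
      using err by (intro order_trans[OF nint_dist_sum] sum_mono) auto
  qed
  also have "\<dots> \<le> (\<Sum>\<sigma>\<in>Pow {..<k}. \<kappa>) + (\<Sum>\<omega>\<in>Pow {..<k}. real k * \<kappa>)"
    using \<kappa> by (intro add_mono sum_mono2) auto
  also have "\<dots> = 2 ^ k * (real k + 1) * \<kappa>" by (simp add: card_Pow algebra_simps)
  finally show ?thesis .
qed

end

end

subsection \<open>Gowers norms on an interval as averages over integer cubes\<close>

lemma e_add: "e (x + y) = e x * e y"
  by (simp add: e_def cis_mult distrib_left)

lemma cnj_e: "cnj (e x) = e (- x)"
  by (simp add: e_def cis_cnj)

lemma e_int [simp]: "e (of_int m) = 1"
  by (simp add: e_def)

lemma norm_e [simp]: "cmod (e x) = 1"
  by (simp add: e_def)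

lemma Re_e_nd: "Re (e x) = cos (2 * pi * nint_dist x)"
proof -
  have "Re (e x) = Re (e (of_int (round x) + (x - of_int (round x))))" by simp
  also have "\<dots> = Re (e (x - of_int (round x)))" unfolding e_add by simp
  also have "\<dots> = cos \<bar>2 * pi * (x - of_int (round x))\<bar>" by (simp add: e_def)
  finally show ?thesis by (simp add: nint_dist_def abs_mult)
qed

lemma norm_cis_minus_1_le: "cmod (cis t - 1) \<le> \<bar>t\<bar>"
proof -
  have "(cmod (cis t - 1))\<^sup>2 = (cos t - 1)\<^sup>2 + (sin t)\<^sup>2" by (simp add: cmod_power2)
  also have "\<dots> = 2 - 2 * cos (2 * (t / 2))"
    using sin_cos_squared_add[of t] by (simp add: power2_eq_square algebra_simps)
  also have "\<dots> = (2 * sin (t / 2))\<^sup>2"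
    unfolding cos_double_sin by (simp add: power2_eq_square)
  also have "\<dots> = (2 * \<bar>sin (t / 2)\<bar>)\<^sup>2" by (simp add: power_mult_distrib)
  also have "\<dots> \<le> \<bar>t\<bar>\<^sup>2"
    using abs_sin_x_le_abs_x[of "t / 2"] by (intro power_mono) auto
  finally show ?thesis by (rule power2_le_imp_le) simp
qed

lemma norm_e_diff_le: "cmod (e x - e y) \<le> 2 * pi * nint_dist (x - y)"
proof -
  define r where "r = x - y - of_int (round (x - y))"
  have x: "x = y + (of_int (round (x - y)) + r)" by (simp add: r_def)
  have "e x = e y * e r" by (subst x) (simp add: e_add)
  then have "e x - e y = e y * (e r - 1)" by (simp add: algebra_simps)
  then have "cmod (e x - e y) = cmod (cis (2 * pi * r) - 1)" by (simp add: norm_mult e_def)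
  also have "\<dots> \<le> \<bar>2 * pi * r\<bar>" by (rule norm_cis_minus_1_le)
  also have "\<dots> = 2 * pi * nint_dist (x - y)" by (simp add: abs_mult nint_dist_def r_def)
  finally show ?thesis .
qed

lemma ex_phase: "\<exists>F. \<forall>n. f n = of_real (cmod (f n)) * e (F n)"
proof (intro exI allI)
  fix n show "f n = of_real (cmod (f n)) * e (Arg (f n) / (2 * pi))"
    using rcis_cmod_Arg[of "f n"] by (simp add: rcis_def e_def)
qed

section \<open>Cube products and their loss compared with 1\<close>

definition cube_prod :: "nat \<Rightarrow> (int \<Rightarrow> complex) \<Rightarrow> int \<Rightarrow> (nat \<Rightarrow> int) \<Rightarrow> complex" where
  "cube_prod k f x h = (\<Prod>S\<in>Pow {..<k}. (if even (card S) then (\<lambda>z. z) else cnj) (f (x + sum h S)))"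

lemma prod_e: "(\<Prod>a\<in>A. e (g a)) = e (\<Sum>a\<in>A. g a)"
proof (induction A rule: infinite_finite_induct)
  case (insert a A)
  then show ?case by (simp add: e_add)
qed (use e_int[of 0] in simp_all)

lemma cube_prod_polar:
  assumes "\<And>S. S \<subseteq> {..<k} \<Longrightarrow> f (x + sum h S) = of_real (r (x + sum h S)) * e (F (x + sum h S))"
  shows "cube_prod k f x h = of_real (\<Prod>S\<in>Pow {..<k}. r (x + sum h S)) * e (cube_diff {..<k} F x h)"
proof -
  have "cube_prod k f x h
      = (\<Prod>S\<in>Pow {..<k}. of_real (r (x + sum h S)) * e ((-1) ^ card S * F (x + sum h S)))"
    unfolding cube_prod_def using assms by (intro prod.cong refl) (auto simp: cnj_e)
  then show ?thesis by (simp add: prod.distrib prod_e cube_diff_def)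
qed

lemma cubes_base: "(x, h) \<in> cubes k N \<Longrightarrow> x \<in> {1..int N}"
  using cubes_subset by blast

lemma norm_cube_prod_le:
  assumes "(x, h) \<in> cubes k N" and f: "\<And>n. n \<in> {1..int N} \<Longrightarrow> cmod (f n) \<le> 1"
  shows "(\<Prod>S\<in>Pow {..<k}. cmod (f (x + sum h S))) \<le> cmod (f x)"
proof -
  have "(\<Prod>S\<in>Pow {..<k}. cmod (f (x + sum h S)))
      = cmod (f x) * (\<Prod>S\<in>Pow {..<k} - {{}}. cmod (f (x + sum h S)))"
    by (subst prod.remove[of _ "{}"]) auto
  also have "\<dots> \<le> cmod (f x) * 1"
    using assms by (intro mult_left_mono prod_le_1) (auto simp: cubes_def)
  finally show ?thesis by simp
qed

lemma cube_defect:
  assumes xh: "(x, h) \<in> cubes k N" and f: "\<And>n. n \<in> {1..int N} \<Longrightarrow> cmod (f n) \<le> 1"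
    and F: "\<And>n. f n = of_real (cmod (f n)) * e (F n)"
  shows "1 - cmod (f x) \<le> 1 - Re (cube_prod k f x h)"
    and "0 \<le> \<kappa> \<Longrightarrow> \<kappa> \<le> 1 / 4 \<Longrightarrow> \<kappa> < nint_dist (cube_diff {..<k} F x h) \<Longrightarrow>
      1 - cos (2 * pi * \<kappa>) \<le> 1 - Re (cube_prod k f x h)"
proof -
  define p where "p = (\<Prod>S\<in>Pow {..<k}. cmod (f (x + sum h S)))"
  have x: "x \<in> {1..int N}" using xh by (rule cubes_base)
  have p0: "0 \<le> p" unfolding p_def by (intro prod_nonneg) auto
  have px: "p \<le> cmod (f x)" unfolding p_def using xh f by (rule norm_cube_prod_le)
  note p = p0 px order_trans[OF px f[OF x]]
  let ?d = "nint_dist (cube_diff {..<k} F x h)"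
  have Re: "Re (cube_prod k f x h) = p * cos (2 * pi * ?d)"
    using cube_prod_polar[of k f x h "\<lambda>n. cmod (f n)" F] F by (simp add: p_def Re_e_nd del: of_real_prod)
  have "p * cos (2 * pi * ?d) \<le> p * 1" using p by (intro mult_left_mono) auto
  then show "1 - cmod (f x) \<le> 1 - Re (cube_prod k f x h)" using p Re by simp
  assume \<kappa>: "0 \<le> \<kappa>" "\<kappa> \<le> 1 / 4" "\<kappa> < ?d"
  have c0: "0 \<le> cos (2 * pi * \<kappa>)" using \<kappa> by (intro cos_ge_zero) (auto simp: field_simps intro: order_trans[of _ 0])
  have "cos (2 * pi * ?d) \<le> cos (2 * pi * \<kappa>)"
    using \<kappa> nint_dist_le_half[of "cube_diff {..<k} F x h"] by (intro cos_monotone_0_pi_le) auto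
  then have "p * cos (2 * pi * ?d) \<le> p * cos (2 * pi * \<kappa>)" using p by (intro mult_left_mono) auto
  also have "\<dots> \<le> cos (2 * pi * \<kappa>)" using p c0 by (simp add: mult_left_le_one_le)
  finally show "1 - cos (2 * pi * \<kappa>) \<le> 1 - Re (cube_prod k f x h)" using Re by simp
qed

text \<open>The vertices \<open>x\<close> and \<open>x + h i\<close> force a lift of each direction
  to size at most \<open>N\<close>. Any other vertex then differs from its residue in
  \<open>[N]\<close> by less than \<open>(k + 1) * N < M\<close>, so congruence modulo
  \<open>M\<close> becomes equality and no cube wraps around.\<close>

lemma cubes_bij_betw:
  assumes N: "1 \<le> N" and M: "M = 2 ^ k * N + 1"
  shows "bij_betw (\<lambda>(x, h). (x, restrict (\<lambda>i. h i mod int M) {..<k})) (cubes k N)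
    {(x, g). x \<in> {0..<int M} \<and> g \<in> PiE {..<k} (\<lambda>_. {0..<int M}) \<and>
      (\<forall>S\<subseteq>{..<k}. (x + sum g S) mod int M \<in> {1..int N})}"
    (is "bij_betw ?\<rho> _ ?T")
proof -
  have "k + 1 \<le> (2::nat) ^ k" using Suc_leI[OF less_exp[of k]] unfolding Suc_eq_plus1 .
  then have "(k + 1) * N \<le> 2 ^ k * N" by (rule mult_right_mono) simp
  then have "int ((k + 1) * N) \<le> int (2 ^ k * N)" by (simp only: of_nat_le_iff)
  moreover have "int ((k + 1) * N) = (int k + 1) * int N" by (simp add: distrib_right)
  ultimately have kM: "(int k + 1) * int N < int M" unfolding M of_nat_add by linarith
  have NM: "int N < int M" using kM mult_right_mono[of 1 "int k + 1" "int N"] by simp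
  have modN: "y mod int M = y" if "y \<in> {1..int N}" for y using that NM by simp
  have sum_mod: "(x + (\<Sum>i\<in>S. h i mod int M)) mod int M = (x + sum h S) mod int M" for x S h
    by (metis mod_add_right_eq mod_sum_eq)
  have restr: "sum (restrict g {..<k}) S = sum g S" if "S \<subseteq> {..<k}" for g :: "nat \<Rightarrow> int" and S
    using that by (intro sum.cong) auto
  show ?thesis
  proof (rule bij_betw_imageI)
    show "inj_on ?\<rho> (cubes k N)"
    proof (rule inj_onI)
      fix z z' assume "z \<in> cubes k N" "z' \<in> cubes k N" "?\<rho> z = ?\<rho> z'"
      then obtain x h y g where z: "z = (x, h)" "z' = (y, g)"
        and h: "(x, h) \<in> cubes k N" and g: "(y, g) \<in> cubes k N"
        and eq: "(x, restrict (\<lambda>i. h i mod int M) {..<k}) = (y, restrict (\<lambda>i. g i mod int M) {..<k})"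
        by (cases z; cases z') auto
      have "h i = g i" if i: "i < k" for i
      proof -
        have "restrict (\<lambda>i. h i mod int M) {..<k} = restrict (\<lambda>i. g i mod int M) {..<k}" using eq by simp
        from fun_cong[OF this, of i] have m: "h i mod int M = g i mod int M" using i by simp
        have "x + h i \<in> {1..int N}" "x + g i \<in> {1..int N}"
          using h g eq i by (auto simp: cubes_def dest!: spec[of _ "{i}"])
        moreover have "(x + h i) mod int M = (x + g i) mod int M" using m by (metis mod_add_right_eq)
        ultimately show ?thesis using modN[of "x + h i"] modN[of "x + g i"] by simp
      qed
      moreover have "h \<in> extensional {..<k}" "g \<in> extensional {..<k}" using h g by (auto simp: cubes_def)
      ultimately have "h = g" by (intro extensionalityI[of h "{..<k}"]) auto
      then show "z = z'" using eq z by simp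
    qed
    show "?\<rho> ` cubes k N = ?T"
    proof (intro equalityI subsetI)
      fix z assume "z \<in> ?\<rho> ` cubes k N"
      then obtain x h where xh: "(x, h) \<in> cubes k N" and z: "z = (x, restrict (\<lambda>i. h i mod int M) {..<k})"
        by auto
      have "(x + sum (restrict (\<lambda>i. h i mod int M) {..<k}) S) mod int M = x + sum h S" if "S \<subseteq> {..<k}" for S
        unfolding restr[OF that] sum_mod using xh that by (intro modN) (simp add: cubes_def)
      moreover have "x \<in> {1..int N}" using xh by (rule cubes_base)
      ultimately show "z \<in> ?T" using xh z NM by (auto simp: cubes_def)
    next
      fix z assume "z \<in> ?T"
      then obtain x g where z: "z = (x, g)" and x: "x \<in> {0..<int M}" and g: "g \<in> PiE {..<k} (\<lambda>_. {0..<int M})"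
        and v: "\<And>S. S \<subseteq> {..<k} \<Longrightarrow> (x + sum g S) mod int M \<in> {1..int N}" by auto
      have x1: "x \<in> {1..int N}" using v[of "{}"] x by simp
      \<comment> \<open>The lift of \<open>g i\<close> for which \<open>x + h i\<close> is the
        residue lying in \<open>[N]\<close>.\<close>
      define h where "h = restrict (\<lambda>i. (x + g i) mod int M - x) {..<k}"
      have hg: "h i mod int M = g i" if i: "i < k" for i
      proof -
        have "h i mod int M = g i mod int M" using i by (simp add: h_def mod_diff_left_eq)
        then show ?thesis using g i by (auto simp: PiE_iff)
      qed
      have hb: "\<bar>h i\<bar> \<le> int N" if i: "i < k" for i
        using v[of "{i}"] i x1 by (auto simp: h_def)
      have "x + sum h S \<in> {1..int N}" if S: "S \<subseteq> {..<k}" for S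
      proof -
        define r where "r = (x + sum g S) mod int M"
        have r: "r \<in> {1..int N}" using v[OF S] by (simp add: r_def)
        have "(\<Sum>i\<in>S. h i mod int M) = sum g S" using hg S by (intro sum.cong) auto
        then have "(x + sum h S) mod int M = r mod int M" using sum_mod[of x h S] by (simp add: r_def)
        then have dvd: "int M dvd x + sum h S - r" by (simp add: mod_eq_dvd_iff)
        have "\<bar>sum h S\<bar> \<le> (\<Sum>i\<in>S. \<bar>h i\<bar>)" by (rule sum_abs)
        also have "\<dots> \<le> int (card S) * int N"
          using sum_bounded_above[of S "\<lambda>i. \<bar>h i\<bar>" "int N"] hb S by auto
        also have "\<dots> \<le> int k * int N" using card_mono[OF _ S] by (intro mult_right_mono) auto
        finally have "\<bar>x + sum h S - r\<bar> < int M"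
          using x1 r kM unfolding distrib_right atLeastAtMost_iff by linarith
        then have "x + sum h S - r = 0" using dvd by (metis dvd_imp_le_int not_le abs_of_nat)
        then show ?thesis using r by simp
      qed
      then have "(x, h) \<in> cubes k N" by (simp add: cubes_def h_def)
      moreover have "restrict (\<lambda>i. h i mod int M) {..<k} = g"
        using g hg by (intro extensionalityI[of _ "{..<k}"]) (auto simp: PiE_iff)
      ultimately show "z \<in> ?\<rho> ` cubes k N" using z by force
    qed
  qed
qed

lemma gowers_cyc_ext0:
  assumes N: "1 \<le> N" and M: "M = 2 ^ k * N + 1"
  shows "gowers_cyc M k (ext0 N f)
    = root (2 ^ k) (Re (\<Sum>(x, h)\<in>cubes k N. cube_prod k f x h) / real M ^ (k + 1))"
proof -
  let ?q = "\<lambda>(x, g). \<Prod>S\<in>Pow {..<k}. (if even (card S) then (\<lambda>z. z) else cnj)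
    (ext0 N f ((x + sum g S) mod int M))"
  let ?T = "{(x, g). x \<in> {0..<int M} \<and> g \<in> PiE {..<k} (\<lambda>_. {0..<int M}) \<and>
      (\<forall>S\<subseteq>{..<k}. (x + sum g S) mod int M \<in> {1..int N})}"
  let ?A = "{0..<int M} \<times> PiE {..<k} (\<lambda>_. {0..<int M})"
  have finA: "finite ?A" by (intro finite_cartesian_product finite_PiE) auto
  have "sum ?q ?A = sum ?q ?T"
  proof (rule sum.mono_neutral_right[OF finA])
    show "?T \<subseteq> ?A" by auto
    show "\<forall>z\<in>?A - ?T. ?q z = 0"
    proof
      fix z assume "z \<in> ?A - ?T"
      then obtain x g S where z: "z = (x, g)" and
        S: "S \<subseteq> {..<k}" "(x + sum g S) mod int M \<notin> {1..int N}" by auto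
      then have "ext0 N f ((x + sum g S) mod int M) = 0" by (auto simp: ext0_def)
      then show "?q z = 0"
        unfolding z prod.case using S(1) by (intro prod_zero bexI[of _ S]) auto
    qed
  qed
  also have "sum ?q ?T
      = (\<Sum>z\<in>cubes k N. ?q ((\<lambda>(x, h). (x, restrict (\<lambda>i. h i mod int M) {..<k})) z))"
    using sum.reindex_bij_betw[OF cubes_bij_betw[OF N M], of ?q] by simp
  also have "\<dots> = (\<Sum>(x, h)\<in>cubes k N. cube_prod k f x h)"
  proof (intro sum.cong refl)
    fix z assume "z \<in> cubes k N"
    then obtain x h where z: "z = (x, h)" and xh: "(x, h) \<in> cubes k N" by (cases z) auto
    have "1 * N \<le> 2 ^ k * N" by (intro mult_right_mono) auto
    then have NM: "int N < int M" unfolding M by linarith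
    have "ext0 N f ((x + sum (restrict (\<lambda>i. h i mod int M) {..<k}) S) mod int M) = f (x + sum h S)"
      if S: "S \<subseteq> {..<k}" for S
    proof -
      have v: "x + sum h S \<in> {1..int N}" using xh S by (auto simp: cubes_def)
      have "sum (restrict (\<lambda>i. h i mod int M) {..<k}) S = (\<Sum>i\<in>S. h i mod int M)"
        using S by (intro sum.cong) auto
      then have "(x + sum (restrict (\<lambda>i. h i mod int M) {..<k}) S) mod int M = (x + sum h S) mod int M"
        by (metis mod_add_right_eq mod_sum_eq)
      then show ?thesis using v NM by (simp add: ext0_def)
    qed
    then show "?q ((\<lambda>(x, h). (x, restrict (\<lambda>i. h i mod int M) {..<k})) z)
      = (case z of (x, h) \<Rightarrow> cube_prod k f x h)"
      unfolding z cube_prod_def prod.case by (intro prod.cong refl) (simp del: restrict_apply)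
  qed
  finally have eq: "(\<Sum>x\<in>{0..<int M}. \<Sum>g\<in>PiE {..<k} (\<lambda>_. {0..<int M}). ?q (x, g))
      = (\<Sum>(x, h)\<in>cubes k N. cube_prod k f x h)"
    by (simp add: sum.cartesian_product)
  have Re: "Re (1 / of_nat M ^ (k + 1) * z) = Re z / real M ^ (k + 1)" for z :: complex
  proof -
    have "1 / of_nat M ^ (k + 1) * z = z / of_real (real M ^ (k + 1))" by simp
    then show ?thesis by (simp only: Re_divide_of_real)
  qed
  show ?thesis unfolding gowers_cyc_def using eq by (simp only: Re prod.case)
qed

lemma card_cubes_pos:
  assumes "1 \<le> N" shows "0 < card (cubes k N)"
proof -
  have "sum (restrict (\<lambda>_. 0) {..<k}) S = (0::int)" if "S \<subseteq> {..<k}" for S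
    using that by (intro sum.neutral) auto
  then have "(1, restrict (\<lambda>_. 0) {..<k}) \<in> cubes k N" using assms by (simp add: cubes_def)
  then show ?thesis using finite_cubes by (auto simp: card_gt_0_iff)
qed

text \<open>The same power of the modulus occurs in the norm of \<open>f\<close> and in the norm of
  the indicator and cancels; every cube product of the constant 1 is 1, so the normalisation is the
  number of cubes.\<close>

lemma gowers_N_cubes:
  assumes N: "1 \<le> N"
  shows "gowers_N k N f = root (2 ^ k) (Re (\<Sum>(x, h)\<in>cubes k N. cube_prod k f x h) / real (card (cubes k N)))"
proof -
  have one: "cube_prod k (\<lambda>_. 1) x h = 1" for x h
    unfolding cube_prod_def by (intro prod.neutral) auto
  have "0 < 1 + 2 ^ k * real N" by (intro add_pos_nonneg) auto
  then show ?thesis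
    unfolding gowers_N_def gowers_cyc_ext0[OF N refl] one
    by (simp add: split_def flip: real_root_divide)
qed

lemma card_cubes_le: "card (cubes k N) \<le> (3 * N) ^ (k + 1)"
proof -
  have "card (cubes k N) \<le> card ({1..int N} \<times> PiE {..<k} (\<lambda>_. {-int N..int N}))"
    by (intro card_mono cubes_subset finite_cartesian_product finite_PiE) auto
  also have "\<dots> = N * (2 * N + 1) ^ k"
  proof -
    have "card {-int N..int N} = 2 * N + 1" unfolding card_atLeastAtMost_int by linarith
    then show ?thesis by (simp add: card_cartesian_product card_PiE)
  qed
  also have "\<dots> \<le> (3 * N) ^ (k + 1)"
  proof (cases "N = 0")
    case False
    then have "N * (2 * N + 1) ^ k \<le> (3 * N) * (3 * N) ^ k" by (intro mult_mono power_mono) auto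
    then show ?thesis by simp
  qed simp
  finally show ?thesis .
qed

subsection \<open>Extremisers and near-extremisers\<close>

definition gowers_ratio :: "nat \<Rightarrow> nat \<Rightarrow> (int \<Rightarrow> complex) \<Rightarrow> real" where
  "gowers_ratio k N f = Re (\<Sum>(x, h)\<in>cubes k N. cube_prod k f x h) / real (card (cubes k N))"

lemma sum_cube_defect:
  assumes "1 \<le> N"
  shows "(\<Sum>(x, h)\<in>cubes k N. 1 - Re (cube_prod k f x h)) = (1 - gowers_ratio k N f) * card (cubes k N)"
proof -
  have "(\<Sum>(x, h)\<in>cubes k N. 1 - Re (cube_prod k f x h))
      = card (cubes k N) - Re (\<Sum>(x, h)\<in>cubes k N. cube_prod k f x h)"
    by (simp add: split_def sum_subtractf)
  then show ?thesis
    using card_cubes_pos[OF assms, of k] unfolding gowers_ratio_def left_diff_distrib by (simp del: Re_sum)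
qed

lemma restrict_in_cubes:
  assumes "1 \<le> x" "\<forall>i<k. 0 \<le> t i" "x + sum t {..<k} \<le> int N"
  shows "(x, restrict t {..<k}) \<in> cubes k N"
proof -
  have "x + sum (restrict t {..<k}) S \<in> {1..int N}" if S: "S \<subseteq> {..<k}" for S
  proof -
    have "sum (restrict t {..<k}) S = sum t S" using S by (intro sum.cong) auto
    moreover have "0 \<le> sum t S" using assms(2) S by (intro sum_nonneg) auto
    moreover have "sum t S \<le> sum t {..<k}" using assms(2) S by (intro sum_mono2) auto
    ultimately show ?thesis using assms by simp
  qed
  then show ?thesis by (simp add: cubes_def)
qed

lemma gowers_N_poly_phase:
  assumes k: "1 \<le> k" and N: "1 \<le> N" and P: "poly_RZ (k - 1) P" and f: "\<forall>n\<in>{1..int N}. f n = e (P n)"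
  shows "gowers_N k N f = 1"
proof -
  have "cube_prod k f x h = 1" if "(x, h) \<in> cubes k N" for x h
  proof -
    have "cube_diff {..<k} P x h \<in> \<int>" using P k by (simp add: poly_RZ_iff_cube_diff)
    then have "e (cube_diff {..<k} P x h) = 1" by (auto elim!: Ints_cases)
    then show ?thesis
      using cube_prod_polar[of k f x h "\<lambda>_. 1" P] f that by (simp add: cubes_def)
  qed
  then have "(\<Sum>(x, h)\<in>cubes k N. cube_prod k f x h) = (\<Sum>z\<in>cubes k N. 1)"
    by (intro sum.cong) auto
  then show ?thesis using card_cubes_pos[OF N, of k] by (simp add: gowers_N_cubes[OF N])
qed

lemma gowers_extremiser:
  assumes k: "1 \<le> k" and N: "k < N" and f: "\<And>n. n \<in> {1..int N} \<Longrightarrow> cmod (f n) \<le> 1"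
    and eq: "gowers_N k N f = 1"
  shows "\<exists>P. poly_RZ (k - 1) P \<and> (\<forall>n\<in>{1..int N}. f n = e (P n))"
proof -
  have N1: "1 \<le> N" using N by simp
  obtain F where F: "\<And>n. f n = of_real (cmod (f n)) * e (F n)" using ex_phase by metis
  have "gowers_ratio k N f = 1" using eq by (simp add: gowers_N_cubes[OF N1] gowers_ratio_def)
  then have sum0: "(\<Sum>(x, h)\<in>cubes k N. 1 - Re (cube_prod k f x h)) = 0"
    using sum_cube_defect[OF N1, of k f] by simp
  have nonneg: "0 \<le> 1 - Re (cube_prod k f x h)" if "(x, h) \<in> cubes k N" for x h
    using cube_defect(1)[where f = f and F = F, OF that f F] f[OF cubes_base[OF that]] by linarith
  have zero: "1 - Re (cube_prod k f x h) = 0" if "(x, h) \<in> cubes k N" for x h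
  proof -
    have "\<forall>z\<in>cubes k N. (\<lambda>(x, h). 1 - Re (cube_prod k f x h)) z = 0"
      using sum0 finite_cubes nonneg by (subst sum_nonneg_eq_0_iff[symmetric]) auto
    then show ?thesis using that by auto
  qed
  have norm1: "cmod (f n) = 1" if n: "n \<in> {1..int N}" for n
  proof -
    \<comment> \<open>The degenerate cube with all directions 0 exists at every point, so the
      modulus can be read off even at the ends of the interval.\<close>
    have "(n, restrict (\<lambda>_. 0) {..<k}) \<in> cubes k N" using n by (intro restrict_in_cubes) auto
    from cube_defect(1)[where f = f and F = F, OF this f F] zero[OF this] f[OF n] show ?thesis by simp
  qed
  have nd0: "nint_dist (cube_diff {..<k} F x h) = 0" if xh: "(x, h) \<in> cubes k N" for x h
  proof (rule ccontr)
    assume "nint_dist (cube_diff {..<k} F x h) \<noteq> 0"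
    then have pos: "0 < nint_dist (cube_diff {..<k} F x h)" using nint_dist_nonneg by (simp add: less_le)
    \<comment> \<open>Half the distance meets both the strict inequality and the bound
      \<open>1 / 4\<close> required by \<open>cube_defect\<close>.\<close>
    define \<kappa> where "\<kappa> = nint_dist (cube_diff {..<k} F x h) / 2"
    have \<kappa>: "0 < \<kappa>" "\<kappa> \<le> 1 / 4" "\<kappa> < nint_dist (cube_diff {..<k} F x h)"
      using pos nint_dist_le_half[of "cube_diff {..<k} F x h"] by (auto simp: \<kappa>_def)
    have "1 - cos (2 * pi * \<kappa>) \<le> 0" using cube_defect(2)[where f = f and F = F, OF xh f F, of \<kappa>] \<kappa> zero[OF xh] by simp
    moreover have "cos (2 * pi * \<kappa>) < cos 0" using \<kappa> by (intro cos_monotone_0_pi) auto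
    ultimately show False by simp
  qed
  obtain C where C: "\<forall>(N::nat) G \<eta>. k < N \<longrightarrow> 3 * \<eta> < 1 \<longrightarrow>
     (\<forall>x t. 1 \<le> x \<longrightarrow> (\<forall>i<k. 0 \<le> t i) \<longrightarrow> x + sum t {..<k} \<le> int N \<longrightarrow> nint_dist (cube_diff {..<k} G x t) \<le> \<eta>) \<longrightarrow>
     (\<exists>P. poly_RZ (k - 1) P \<and> (\<forall>x\<in>{1..int N}. nint_dist (G x - P x) \<le> C * \<eta>))"
    using approx_polynomial_mod_one[of k] k by auto
  have "nint_dist (cube_diff {..<k} F x t) \<le> 0"
    if "1 \<le> x" "\<forall>i<k. 0 \<le> t i" "x + sum t {..<k} \<le> int N" for x t
  proof -
    have "cube_diff {..<k} F x t = cube_diff {..<k} F x (restrict t {..<k})" by (intro cube_diff_cong) auto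
    then show ?thesis using nd0[OF restrict_in_cubes[OF that]] by simp
  qed
  then obtain P where P: "poly_RZ (k - 1) P" "\<forall>n\<in>{1..int N}. nint_dist (F n - P n) \<le> C * 0"
    using C[rule_format, of N 0 F] N by auto
  have "f n = e (P n)" if n: "n \<in> {1..int N}" for n
  proof -
    have "nint_dist (F n - P n) = 0" using P(2) n nint_dist_nonneg[of "F n - P n"] by (simp add: order_antisym)
    then have "e (F n) = e (P n)" using norm_e_diff_le[of "F n" "P n"] by simp
    then show ?thesis using F[of n] norm1[OF n] by simp
  qed
  with P show ?thesis by blast
qed

text \<open>A bad cube has defect at least \<psi>, so there are at most
  \<open>\<tau> / \<psi> * L ^ (k + 1)\<close> of them. In the conclusion \<tau> pays for moduli
  below 1; \<open>4 * \<tau> / \<psi>\<close> for the at most \<open>2 * \<tau> / \<psi> * L\<close>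
  points where \<open>F\<close> is far from its correction, each costing at most 2; the last term
  for the phase error elsewhere. The factor \<open>96 * k^2\<close> comes from at most
  \<open>(3 * N) ^ (k + 1)\<close> cubes and \<open>N \<le> 32 * k^2 * L\<close>.\<close>

lemma gowers_near_extremiser_quantitative:
  assumes k: "1 \<le> k" and N: "16 * k\<^sup>2 \<le> N" and f: "\<And>n. n \<in> {1..int N} \<Longrightarrow> cmod (f n) \<le> 1"
    and C: "0 \<le> C" and rigid: "\<forall>(N::nat) G \<eta>. k < N \<longrightarrow> 3 * \<eta> < 1 \<longrightarrow>
     (\<forall>x t. 1 \<le> x \<longrightarrow> (\<forall>i<k. 0 \<le> t i) \<longrightarrow> x + sum t {..<k} \<le> int N \<longrightarrow> nint_dist (cube_diff {..<k} G x t) \<le> \<eta>) \<longrightarrow>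
     (\<exists>P. poly_RZ (k - 1) P \<and> (\<forall>x\<in>{1..int N}. nint_dist (G x - P x) \<le> C * \<eta>))"
    and \<kappa>: "0 < \<kappa>" "\<kappa> \<le> 1 / 4" "3 * (2 ^ k * (real k + 1) * \<kappa>) < 1"
    and \<psi>: "\<psi> = 1 - cos (2 * pi * \<kappa>)"
    and \<tau>: "0 \<le> \<tau>" "2 ^ k * (real k + 1) * \<tau> < \<psi>"
    and ratio: "(1 - gowers_ratio k N f) * (96 * real k ^ 2) ^ (k + 1) \<le> \<tau>"
  shows "\<exists>P. poly_RZ (k - 1) P \<and>
    L1_N N (\<lambda>n. f n - e (P n)) \<le> \<tau> + 4 * \<tau> / \<psi> + 2 * pi * ((real k + 1 + C * (2 ^ k * (real k + 1))) * \<kappa>)"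
proof -
  \<comment> \<open>The largest noise range that \<open>[N]\<close> permits. Since
    \<open>L \<ge> 1\<close>, rounding down loses at most a factor 2, so
    \<open>N \<le> 32 * k^2 * L\<close>.\<close>
  define L where "L = N div (16 * k\<^sup>2)"
  have k2: "0 < 16 * k\<^sup>2" using k by simp
  have L1: "1 \<le> L" unfolding L_def using N k2 by (simp add: div_greater_zero_iff Suc_le_eq)
  have LN: "16 * k\<^sup>2 * L \<le> N" unfolding L_def by simp
  have "N < 16 * k\<^sup>2 * (L + 1)" unfolding L_def using dividend_less_times_div[OF k2, of N] by simp
  also have "\<dots> \<le> 16 * k\<^sup>2 * (2 * L)" using L1 by (intro mult_left_mono) auto
  finally have NL: "N \<le> 32 * k\<^sup>2 * L" by simp
  have "k < 16 * k\<^sup>2" using k by (simp add: power2_eq_square)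
  then have kN: "k < N" using N by simp
  have N1: "1 \<le> N" using kN by simp
  have LleN: "L \<le> N" using LN k2 by (metis div_le_dividend L_def)
  have "real (card (cubes k N)) \<le> real ((3 * N) ^ (k + 1))"
    using card_cubes_le[of k N] by (simp only: of_nat_le_iff)
  also have "\<dots> = (3 * real N) ^ (k + 1)" by simp
  also have "\<dots> \<le> (96 * real k ^ 2 * real L) ^ (k + 1)"
  proof (rule power_mono)
    have "real N \<le> real (32 * k\<^sup>2 * L)" using NL by (simp only: of_nat_le_iff)
    then have "real N \<le> 32 * real k ^ 2 * real L" by simp
    then show "3 * real N \<le> 96 * real k ^ 2 * real L" by linarith
  qed simp
  also have "\<dots> = (96 * real k ^ 2) ^ (k + 1) * real L ^ (k + 1)" by (rule power_mult_distrib)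
  finally have card_le: "real (card (cubes k N)) \<le> (96 * real k ^ 2) ^ (k + 1) * real L ^ (k + 1)" .
  obtain F where F: "\<And>n. f n = of_real (cmod (f n)) * e (F n)" using ex_phase by metis
  interpret self_correction k N L F \<kappa>
    by unfold_locales (use k L1 LN in auto)
  let ?q = "\<lambda>(x, h). 1 - Re (cube_prod k f x h)"
  have nonneg: "0 \<le> ?q z" if "z \<in> cubes k N" for z
  proof -
    obtain x h where z: "z = (x, h)" by (cases z)
    then show ?thesis using cube_defect(1)[of x h k N f F] f F cubes_base[of x h k N] that by force
  qed
  have defect: "sum ?q (cubes k N) \<le> \<tau> * real L ^ (k + 1)"
  proof -
    have "0 \<le> sum ?q (cubes k N)" using nonneg by (rule sum_nonneg)
    then have "0 \<le> 1 - gowers_ratio k N f"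
      unfolding sum_cube_defect[OF N1] using card_cubes_pos[OF N1, of k] by (simp add: zero_le_mult_iff)
    then have "sum ?q (cubes k N) \<le> (1 - gowers_ratio k N f) * ((96 * real k ^ 2) ^ (k + 1) * real L ^ (k + 1))"
      unfolding sum_cube_defect[OF N1] using card_le by (intro mult_left_mono)
    also have "\<dots> \<le> \<tau> * real L ^ (k + 1)"
      unfolding mult.assoc[symmetric] using ratio by (intro mult_right_mono) auto
    finally show ?thesis .
  qed
  have \<psi>0: "0 < \<psi>"
  proof -
    have "0 \<le> 2 ^ k * (real k + 1) * \<tau>" using \<tau> by simp
    then show ?thesis using \<tau> by linarith
  qed
  have bad_le: "real (card bad) * \<psi> \<le> \<tau> * real L ^ (k + 1)"
  proof -
    have "real (card bad) * \<psi> = (\<Sum>z\<in>bad. \<psi>)" by simp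
    also have "\<dots> \<le> sum ?q bad"
    proof (rule sum_mono)
      fix z assume "z \<in> bad"
      then show "\<psi> \<le> ?q z"
        unfolding bad_def \<psi> using cube_defect(2)[of _ _ k N f F \<kappa>] f F \<kappa> by auto
    qed
    also have "\<dots> \<le> sum ?q (cubes k N)"
      using nonneg by (intro sum_mono2 finite_cubes) (auto simp: bad_def)
    finally show ?thesis using defect by simp
  qed
  have L0: "0 < real L" using L1 by simp
  have small: "2 ^ k * (k + 1) * card bad < L ^ (k + 1)"
  proof -
    have "2 ^ k * (real k + 1) * (real (card bad) * \<psi>) \<le> 2 ^ k * (real k + 1) * (\<tau> * real L ^ (k + 1))"
      using bad_le by (intro mult_left_mono) auto
    also have "\<dots> = (2 ^ k * (real k + 1) * \<tau>) * real L ^ (k + 1)" by simp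
    also have "\<dots> < \<psi> * real L ^ (k + 1)" using \<tau>(2) L0 by (intro mult_strict_right_mono) auto
    finally have "\<psi> * (2 ^ k * (real k + 1) * real (card bad)) < \<psi> * real L ^ (k + 1)"
      by (simp add: mult_ac)
    then have "2 ^ k * (real k + 1) * real (card bad) < real L ^ (k + 1)"
      using \<psi>0 by (simp only: mult_less_cancel_left_pos)
    then have "real (2 ^ k * (k + 1) * card bad) < real (L ^ (k + 1))"
      unfolding of_nat_mult of_nat_power of_nat_add by simp
    then show ?thesis by (simp only: of_nat_less_iff)
  qed
  have small2: "2 * k * card bad \<le> L ^ (k + 1)"
  proof -
    have "2 ^ 1 \<le> (2::nat) ^ k" using k by (intro power_increasing) auto
    then have "2 * k * card bad \<le> 2 ^ k * (k + 1) * card bad" by (intro mult_mono) auto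
    then show ?thesis using small by linarith
  qed
  define \<eta> where "\<eta> = 2 ^ k * (real k + 1) * \<kappa>"
  have "nint_dist (cube_diff {..<k} corrected x t) \<le> \<eta>"
    if "1 \<le> x" "\<forall>i<k. 0 \<le> t i" "x + sum t {..<k} \<le> int N" for x t
  proof -
    have "cube_diff {..<k} corrected x t = cube_diff {..<k} corrected x (restrict t {..<k})"
      by (intro cube_diff_cong) auto
    moreover have "nint_dist (cube_diff {..<k} corrected x (restrict t {..<k})) \<le> \<eta>"
      unfolding \<eta>_def using restrict_in_cubes[OF that] small \<kappa>
      by (intro nint_dist_cube_diff_corrected_le) (auto simp: cubes_def)
    ultimately show ?thesis by simp
  qed
  then obtain P where P: "poly_RZ (k - 1) P" and near: "\<And>n. n \<in> {1..int N} \<Longrightarrow> nint_dist (corrected n - P n) \<le> C * \<eta>"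
    using rigid[rule_format, of N \<eta> corrected] kN \<kappa>(3) unfolding \<eta>_def by blast
  define X where "X = {x \<in> {1..int N}. (real k + 1) * \<kappa> < nint_dist (F x - corrected x)}"
  define D where "D = 2 * pi * ((real k + 1) * \<kappa> + C * \<eta>)"
  have D0: "0 \<le> D" using C \<kappa> by (simp add: D_def \<eta>_def)
  have Lk: "0 < real L ^ k" using L0 by simp
  have X: "real (card X) \<le> 2 * \<tau> / \<psi> * real L"
  proof -
    have "real (card X * L ^ k) \<le> real (2 * card bad)"
      using card_far_le[OF small2] unfolding X_def of_nat_le_iff .
    then have "real (card X) * real L ^ k \<le> 2 * real (card bad)" by simp
    also have "\<dots> \<le> 2 * (\<tau> * real L ^ (k + 1) / \<psi>)"
      using bad_le \<psi>0 by (simp add: field_simps)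
    also have "\<dots> = (2 * \<tau> / \<psi> * real L) * real L ^ k" by simp
    finally show ?thesis using Lk by (simp only: mult_le_cancel_right_pos)
  qed
  \<comment> \<open>Each \<open>n\<close> is the corner of \<open>H ^ k \<ge> L ^ k\<close> box
    cubes, and each of these has defect at least \<open>1 - cmod (f n)\<close>.\<close>
  have mass: "(\<Sum>n\<in>{1..int N}. 1 - cmod (f n)) \<le> \<tau> * real L"
  proof -
    have "(\<Sum>n\<in>{1..int N}. 1 - cmod (f n)) * real L ^ k \<le> (\<Sum>n\<in>{1..int N}. (1 - cmod (f n)) * real (card (Box n)))"
      unfolding sum_distrib_right
      using f L_le_H by (intro sum_mono mult_left_mono) (auto simp: card_Box intro: power_mono)
    also have "\<dots> = (\<Sum>n\<in>{1..int N}. \<Sum>h\<in>Box n. 1 - cmod (f n))" by (simp add: mult.commute)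
    also have "\<dots> = (\<Sum>(n, h)\<in>Sigma {1..int N} Box. 1 - cmod (f n))"
      using finite_Box by (intro sum.Sigma) auto
    also have "\<dots> \<le> sum ?q (Sigma {1..int N} Box)"
      using cube_defect(1)[of _ _ k N f F] f F Box_cubes by (intro sum_mono) force
    also have "\<dots> \<le> sum ?q (cubes k N)"
      using nonneg Box_cubes by (intro sum_mono2 finite_cubes) auto
    also have "\<dots> \<le> (\<tau> * real L) * real L ^ k" using defect by (simp add: mult_ac)
    finally show ?thesis using Lk by (simp only: mult_le_cancel_right_pos)
  qed
  have point: "cmod (f n - e (P n)) \<le> (1 - cmod (f n)) + 2 * of_bool (n \<in> X) + D" if n: "n \<in> {1..int N}" for n
  proof -
    have "f n - e (P n) = of_real (cmod (f n) - 1) * e (F n) + (e (F n) - e (P n))"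
      by (subst F) (simp add: algebra_simps)
    then have "cmod (f n - e (P n)) \<le> cmod (of_real (cmod (f n) - 1) * e (F n)) + cmod (e (F n) - e (P n))"
      by (metis norm_triangle_ineq)
    also have "cmod (of_real (cmod (f n) - 1) * e (F n)) = 1 - cmod (f n)"
      unfolding norm_mult norm_of_real using f[OF n] by simp
    finally have 1: "cmod (f n - e (P n)) \<le> 1 - cmod (f n) + cmod (e (F n) - e (P n))" .
    show ?thesis
    proof (cases "n \<in> X")
      case True
      have "cmod (e (F n) - e (P n)) \<le> 2" using norm_triangle_ineq4[of "e (F n)" "e (P n)"] by simp
      then show ?thesis using 1 True D0 by simp
    next
      case False
      then have "nint_dist (F n - corrected n) \<le> (real k + 1) * \<kappa>" using n by (auto simp: X_def)
      then have "nint_dist (F n - P n) \<le> (real k + 1) * \<kappa> + C * \<eta>"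
        using near[OF n] nint_dist_add[of "F n - corrected n" "corrected n - P n"] by simp
      then have "2 * pi * nint_dist (F n - P n) \<le> D" unfolding D_def by (intro mult_left_mono) auto
      then show ?thesis using 1 False norm_e_diff_le[of "F n" "P n"] by simp
    qed
  qed
  have "(\<Sum>n\<in>{1..int N}. cmod (f n - e (P n))) \<le> (\<Sum>n\<in>{1..int N}. (1 - cmod (f n)) + 2 * of_bool (n \<in> X) + D)"
    using point by (rule sum_mono)
  also have "\<dots> = (\<Sum>n\<in>{1..int N}. 1 - cmod (f n)) + 2 * real (card X) + real N * D"
  proof -
    have "{1..int N} \<inter> X = X" by (auto simp: X_def)
    then have "(\<Sum>n\<in>{1..int N}. of_bool (n \<in> X)) = real (card X)" by (simp add: sum.If_cases of_bool_def)
    then show ?thesis by (simp add: sum.distrib flip: sum_distrib_left)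
  qed
  also have "\<dots> \<le> \<tau> * real L + 2 * (2 * \<tau> / \<psi> * real L) + real N * D"
    using mass X by (intro add_mono mult_left_mono) auto
  also have "\<dots> = (\<tau> + 4 * \<tau> / \<psi>) * real L + real N * D" by (simp add: algebra_simps)
  also have "\<dots> \<le> (\<tau> + 4 * \<tau> / \<psi>) * real N + real N * D"
    using LleN \<tau> \<psi>0 by (intro add_mono mult_left_mono) auto
  finally have "(\<Sum>n\<in>{1..int N}. cmod (f n - e (P n))) \<le> (\<tau> + 4 * \<tau> / \<psi> + D) * real N"
    by (simp add: algebra_simps)
  then have "L1_N N (\<lambda>n. f n - e (P n)) \<le> \<tau> + 4 * \<tau> / \<psi> + D"
    using N1 by (simp add: L1_N_def pos_divide_le_eq)
  moreover have "D = 2 * pi * ((real k + 1 + C * (2 ^ k * (real k + 1))) * \<kappa>)"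
    by (simp add: D_def \<eta>_def distrib_right mult.assoc)
  ultimately show ?thesis using P by auto
qed

lemma gowers_near_extremiser:
  assumes k: "1 \<le> k" and \<eta>: "0 < \<eta>"
  shows "\<exists>\<delta>>0. \<forall>N f \<epsilon>. 16 * k\<^sup>2 \<le> N \<longrightarrow> (\<forall>n\<in>{1..int N}. cmod (f n) \<le> 1) \<longrightarrow> \<epsilon> \<le> \<delta> \<longrightarrow>
    1 - \<epsilon> \<le> gowers_N k N f \<longrightarrow> (\<exists>P. poly_RZ (k - 1) P \<and> L1_N N (\<lambda>n. f n - e (P n)) \<le> \<eta>)"
proof -
  obtain C where C: "0 \<le> C" and rigid: "\<forall>(N::nat) G \<eta>. k < N \<longrightarrow> 3 * \<eta> < 1 \<longrightarrow>
     (\<forall>x t. 1 \<le> x \<longrightarrow> (\<forall>i<k. 0 \<le> t i) \<longrightarrow> x + sum t {..<k} \<le> int N \<longrightarrow> nint_dist (cube_diff {..<k} G x t) \<le> \<eta>) \<longrightarrow>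
     (\<exists>P. poly_RZ (k - 1) P \<and> (\<forall>x\<in>{1..int N}. nint_dist (G x - P x) \<le> C * \<eta>))"
    using approx_polynomial_mod_one[of k] k by auto
  define a where "a = 2 ^ k * (real k + 1)"
  define b where "b = 2 * pi * (real k + 1 + C * a)"
  define A where "A = (96 * real k ^ 2) ^ (k + 1)"
  have a: "0 < a" by (simp add: a_def)
  have b: "0 < b" using C a by (simp add: b_def add_pos_nonneg)
  have A: "0 < A" using k by (simp add: A_def)
  \<comment> \<open>The three entries keep the cosine nonnegative, the differences of the corrected
    function below 1/3 as lifting requires, and the uniform phase error at most
    \<open>\<eta> / 3\<close>.\<close>
  define \<kappa> where "\<kappa> = min (1 / 4) (min (1 / (4 * a)) (\<eta> / (3 * b)))"
  have \<kappa>: "0 < \<kappa>" "\<kappa> \<le> 1 / 4" using a b \<eta> by (auto simp: \<kappa>_def)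
  have "a * \<kappa> \<le> a * (1 / (4 * a))" using a by (intro mult_left_mono) (auto simp: \<kappa>_def)
  then have a\<kappa>: "3 * (a * \<kappa>) < 1" using a by simp
  have "b * \<kappa> \<le> b * (\<eta> / (3 * b))" using b by (intro mult_left_mono) (auto simp: \<kappa>_def)
  then have b\<kappa>: "b * \<kappa> \<le> \<eta> / 3" using b by simp
  define \<psi> where "\<psi> = 1 - cos (2 * pi * \<kappa>)"
  have "cos (2 * pi * \<kappa>) < cos 0" using \<kappa> by (intro cos_monotone_0_pi) auto
  then have \<psi>: "0 < \<psi>" by (simp add: \<psi>_def)
  \<comment> \<open>The first entry makes bad cubes rare enough for self-correction; the others
    bound the loss of modulus \<tau> and the exceptional points \<open>4 * \<tau> / \<psi>\<close>
    by \<open>\<eta> / 3\<close> each.\<close>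
  define \<tau> where "\<tau> = min (\<psi> / (2 * a)) (min (\<eta> / 3) (\<eta> * \<psi> / 12))"
  have \<tau>: "0 < \<tau>" "\<tau> \<le> \<eta> / 3" using a \<psi> \<eta> by (auto simp: \<tau>_def)
  have "a * \<tau> \<le> a * (\<psi> / (2 * a))" using a by (intro mult_left_mono) (auto simp: \<tau>_def)
  then have a\<tau>: "a * \<tau> < \<psi>" using a \<psi> by simp
  have "4 * \<tau> / \<psi> \<le> 4 * (\<eta> * \<psi> / 12) / \<psi>" using \<psi> by (intro divide_right_mono) (auto simp: \<tau>_def)
  then have \<tau>\<psi>: "4 * \<tau> / \<psi> \<le> \<eta> / 3" using \<psi> by simp
  \<comment> \<open>Bernoulli's inequality costs the factor \<open>2 ^ k\<close> when the root is
    undone, and \<open>A\<close> is the factor relating the number of cubes to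
    \<open>L ^ (k + 1)\<close>. The entry 1 keeps \<open>1 - \<delta>\<close> nonnegative, so that
    powers preserve the inequality.\<close>
  define \<delta> where "\<delta> = min 1 (\<tau> / (2 ^ k * A))"
  have \<delta>: "0 < \<delta>" using \<tau> A by (simp add: \<delta>_def)
  show ?thesis
  proof (intro exI[of _ \<delta>] conjI allI impI \<delta>)
    fix N f \<epsilon>
    assume N: "16 * k\<^sup>2 \<le> N" and f: "\<forall>n\<in>{1..int N}. cmod (f n) \<le> 1" and \<epsilon>: "\<epsilon> \<le> \<delta>"
      and g: "1 - \<epsilon> \<le> gowers_N k N f"
    have "0 < k\<^sup>2" using k by simp
    then have N1: "1 \<le> N" using N by linarith
    have \<delta>1: "\<delta> \<le> 1" by (simp add: \<delta>_def)
    have root: "1 - \<delta> \<le> root (2 ^ k) (gowers_ratio k N f)"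
      using g \<epsilon> by (simp add: gowers_N_cubes[OF N1] gowers_ratio_def)
    then have "0 \<le> root (2 ^ k) (gowers_ratio k N f)" using \<delta>1 by linarith
    \<comment> \<open>\<open>root\<close> keeps the sign of its argument even for an even index, so
      nonnegativity passes from the root to the ratio.\<close>
    then have r0: "0 \<le> gowers_ratio k N f" by simp
    have "1 + real (2 ^ k) * (- \<delta>) \<le> (1 + - \<delta>) ^ (2 ^ k)"
      using \<delta>1 by (intro Bernoulli_inequality) simp
    also have "\<dots> \<le> root (2 ^ k) (gowers_ratio k N f) ^ (2 ^ k)" using root \<delta>1 by (intro power_mono) auto
    also have "\<dots> = gowers_ratio k N f" using r0 by simp
    finally have "1 - gowers_ratio k N f \<le> 2 ^ k * \<delta>" by simp
    also have "\<dots> \<le> 2 ^ k * (\<tau> / (2 ^ k * A))" by (intro mult_left_mono) (auto simp: \<delta>_def)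
    also have "\<dots> = \<tau> / A" by simp
    finally have "(1 - gowers_ratio k N f) * A \<le> \<tau>" using A by (simp add: pos_le_divide_eq)
    then have "\<exists>P. poly_RZ (k - 1) P \<and> L1_N N (\<lambda>n. f n - e (P n)) \<le> \<tau> + 4 * \<tau> / \<psi>
        + 2 * pi * ((real k + 1 + C * (2 ^ k * (real k + 1))) * \<kappa>)"
      using f \<kappa> a\<kappa> a\<tau> \<tau> unfolding a_def A_def
      by (intro gowers_near_extremiser_quantitative[OF k N _ C rigid _ _ _ \<psi>_def]) auto
    moreover have "\<tau> + 4 * \<tau> / \<psi> + 2 * pi * ((real k + 1 + C * (2 ^ k * (real k + 1))) * \<kappa>) \<le> \<eta>"
      using \<tau>(2) \<tau>\<psi> b\<kappa> unfolding b_def a_def by (simp add: mult.assoc)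
    ultimately show "\<exists>P. poly_RZ (k - 1) P \<and> L1_N N (\<lambda>n. f n - e (P n)) \<le> \<eta>"
      using order_trans by blast
  qed
qed

text \<open>Turns a statement with one \<delta> for each \<eta> into a single function of
  \<epsilon>. The bound \<open>B\<close>, valid for every \<epsilon>, provides a finite value where
  no \<delta> applies.\<close>

lemma ex_modulus:
  fixes R :: "real \<Rightarrow> real \<Rightarrow> bool"
  assumes mono: "\<And>\<epsilon> \<eta> \<eta>'. R \<epsilon> \<eta> \<Longrightarrow> \<eta> \<le> \<eta>' \<Longrightarrow> R \<epsilon> \<eta>'"
    and B: "0 \<le> B" "\<And>\<epsilon>. R \<epsilon> B"
    and small: "\<And>\<eta>. 0 < \<eta> \<Longrightarrow> \<exists>\<delta>>0. \<forall>\<epsilon>\<le>\<delta>. R \<epsilon> \<eta>"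
  shows "\<exists>c::real \<Rightarrow> real. (\<forall>\<epsilon>\<ge>0. 0 \<le> c \<epsilon>) \<and> (c \<longlongrightarrow> 0) (at 0 within {0..}) \<and> (\<forall>\<epsilon>\<ge>0. R \<epsilon> (c \<epsilon>))"
proof -
  define T where "T \<epsilon> = {\<eta>. 0 \<le> \<eta> \<and> R \<epsilon> \<eta>}" for \<epsilon>
  \<comment> \<open>The infimum need not be attained; the correction \<open>+ \<epsilon>\<close> is of no use at \<open>0\<close>, but \<open>c 0\<close> does not enter the limit.\<close>
  define c where "c \<epsilon> = (if \<epsilon> = 0 then B else Inf (T \<epsilon>) + \<epsilon>)" for \<epsilon>
  have bdd: "bdd_below (T \<epsilon>)" for \<epsilon> by (rule bdd_belowI[of _ 0]) (auto simp: T_def)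
  have ne: "T \<epsilon> \<noteq> {}" for \<epsilon> using B by (auto simp: T_def)
  have Inf0: "0 \<le> Inf (T \<epsilon>)" for \<epsilon> using ne by (intro cInf_greatest) (auto simp: T_def)
  have c0: "0 \<le> c \<epsilon>" if "0 \<le> \<epsilon>" for \<epsilon> using Inf0 B that by (simp add: c_def)
  have "R \<epsilon> (c \<epsilon>)" if "0 \<le> \<epsilon>" for \<epsilon>
  proof (cases "\<epsilon> = 0")
    case False
    then have "Inf (T \<epsilon>) < Inf (T \<epsilon>) + \<epsilon>" using that by simp
    then obtain \<eta> where "\<eta> \<in> T \<epsilon>" "\<eta> < Inf (T \<epsilon>) + \<epsilon>" using cInf_lessD[OF ne] by blast
    then show ?thesis using mono[of \<epsilon> \<eta>] False by (simp add: T_def c_def)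
  qed (use B in \<open>simp add: c_def\<close>)
  moreover have "(c \<longlongrightarrow> 0) (at 0 within {0..})"
  proof (rule tendstoI)
    fix r :: real assume r: "0 < r"
    obtain \<delta> where \<delta>: "0 < \<delta>" "\<forall>\<epsilon>\<le>\<delta>. R \<epsilon> (r / 2)" using small[of "r / 2"] r by auto
    have "dist (c \<epsilon>) 0 < r" if \<epsilon>: "0 < \<epsilon>" "\<epsilon> < min \<delta> (r / 2)" for \<epsilon>
    proof -
      have "r / 2 \<in> T \<epsilon>" using \<delta> \<epsilon> r by (simp add: T_def)
      then have "Inf (T \<epsilon>) \<le> r / 2" using bdd by (rule cInf_lower)
      then show ?thesis using c0[of \<epsilon>] \<epsilon> by (simp add: c_def)
    qed
    then show "\<forall>\<^sub>F \<epsilon> in at 0 within {0..}. dist (c \<epsilon>) 0 < r"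
      unfolding eventually_at using \<delta> r by (intro exI[of _ "min \<delta> (r / 2)"]) auto
  qed
  ultimately show ?thesis using c0 by blast
qed

theorem theorem1p11:
  fixes k :: nat
  assumes "k \<ge> 1"
  shows "\<exists>(N0::nat) (c::real \<Rightarrow> real).
     (\<forall>\<epsilon>\<ge>0. c \<epsilon> \<ge> 0) \<and> (c \<longlongrightarrow> 0) (at 0 within {0..}) \<and>
     (\<forall>N f. N \<ge> N0 \<longrightarrow> (\<forall>n\<in>{1..int N}. cmod (f n) \<le> 1) \<longrightarrow>
        ((gowers_N k N f = 1 \<longleftrightarrow>
            (\<exists>P. poly_RZ (k - 1) P \<and> (\<forall>n\<in>{1..int N}. f n = e (P n)))) \<and>
         (\<forall>\<epsilon>\<ge>0. gowers_N k N f \<ge> 1 - \<epsilon> \<longrightarrow>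
            (\<exists>P. poly_RZ (k - 1) P \<and> L1_N N (\<lambda>n. f n - e (P n)) \<le> c \<epsilon>))))"
proof -
  define R where "R \<epsilon> \<eta> \<longleftrightarrow> (\<forall>N f. 16 * k\<^sup>2 \<le> N \<longrightarrow> (\<forall>n\<in>{1..int N}. cmod (f n) \<le> 1) \<longrightarrow>
    1 - \<epsilon> \<le> gowers_N k N f \<longrightarrow> (\<exists>P. poly_RZ (k - 1) P \<and> L1_N N (\<lambda>n. f n - e (P n)) \<le> \<eta>))" for \<epsilon> \<eta>
  \<comment> \<open>Two functions bounded by 1 are at distance at most 2 in mean, so the zero
    polynomial serves as the default for every \<epsilon>.\<close>
  have "R \<epsilon> 2" for \<epsilon>
    unfolding R_def
  proof (intro allI impI exI conjI)
    fix N f assume f: "\<forall>n\<in>{1..int N}. cmod (f n) \<le> 1"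
    show "poly_RZ (k - 1) (\<lambda>_. 0)" by (simp add: poly_RZ_iff_cube_diff cube_diff_def)
    have "cmod (f n - e 0) \<le> 2" if "n \<in> {1..int N}" for n
      using norm_triangle_ineq4[of "f n" "e 0"] f that by force
    then have "(\<Sum>n\<in>{1..int N}. cmod (f n - e 0)) \<le> real N * 2"
      using sum_bounded_above[of "{1..int N}" "\<lambda>n. cmod (f n - e 0)" 2] by simp
    then show "L1_N N (\<lambda>n. f n - e 0) \<le> 2"
      by (cases "N = 0") (simp_all add: L1_N_def pos_divide_le_eq mult.commute)
  qed
  moreover have "\<exists>\<delta>>0. \<forall>\<epsilon>\<le>\<delta>. R \<epsilon> \<eta>" if "0 < \<eta>" for \<eta>
    using gowers_near_extremiser[OF assms that] unfolding R_def by blast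
  moreover have "R \<epsilon> \<eta>'" if "R \<epsilon> \<eta>" "\<eta> \<le> \<eta>'" for \<epsilon> \<eta> \<eta>'
    using that unfolding R_def by (meson order_trans)
  ultimately obtain c where c: "\<forall>\<epsilon>\<ge>0. 0 \<le> c \<epsilon>" "(c \<longlongrightarrow> 0) (at 0 within {0..})" "\<forall>\<epsilon>\<ge>0. R \<epsilon> (c \<epsilon>)"
    using ex_modulus[of R 2] by auto
  show ?thesis
  \<comment> \<open>The threshold for \<open>N\<close> is the smallest that admits the noise range
    \<open>L = 1\<close>; it also exceeds \<open>k\<close>, as the exact case requires.\<close>
  proof (intro exI[of _ "16 * k\<^sup>2"] exI[of _ c] conjI allI impI c(1)[rule_format] c(2))
    fix N f assume N: "16 * k\<^sup>2 \<le> N" and f: "\<forall>n\<in>{1..int N}. cmod (f n) \<le> 1"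
    have "k < 16 * k\<^sup>2" using assms by (simp add: power2_eq_square)
    then have kN: "k < N" using N by simp
    show "gowers_N k N f = 1 \<longleftrightarrow> (\<exists>P. poly_RZ (k - 1) P \<and> (\<forall>n\<in>{1..int N}. f n = e (P n)))"
      using gowers_extremiser[OF assms kN, of f] f gowers_N_poly_phase[OF assms, of N _ f] kN by auto
    fix \<epsilon> :: real assume "0 \<le> \<epsilon>" "1 - \<epsilon> \<le> gowers_N k N f"
    then show "\<exists>P. poly_RZ (k - 1) P \<and> L1_N N (\<lambda>n. f n - e (P n)) \<le> c \<epsilon>"
      using c(3) N f unfolding R_def by blast
  qed
qed

end
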